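(* Let $m\geq 1$ be an integer. There exist uncountably many transcendental analytic functions $\phi:\mathbb{R}\to\mathbb{R}$ such that $\phi(\mathbb{U}_{m\text{-ultra}})\subseteq \mathbb{L}$, where $\mathbb{U}_{m\text{-ultra}}$ is the set of $m$-ultra numbers and $\mathbb{L}$ is the set of Liouville numbers.
   Context: A function $f$ is transcendental if the only complex polynomial $P(x,y)$ with $P(x,f(x))=0$ for all $x$ in the domain of $f$ is the zero polynomial. A real number $\xi$ is a Liouville number if there is a sequence of rationals $p_k/q_k$ with $q_k>1$ and $0<|\xi-p_k/q_k|<q_k^{-k}$ for all $k\geq 1$; $\mathbb{L}$ denotes the set of Liouville numbers. For an algebraic number $\alpha$, $\mathcal{H}(\alpha)$ denotes its height, i.e. the maximum of the absolute values of the coefficients of its primitive minimal polynomial over $\mathbb{Z}$. Let $\exp^{[3]}(x)=e^{e^{e^x}}$. A real number $\xi$ is an $m$-ultra number if there exist infinitely many real algebraic numbers $(\alpha_n)_{n\geq1}$ of degree $m$ such that $0<|\xi-\alpha_n|<(\exp^{[3]}(\mathcal{H}(\alpha_n)))^{-n}$ for $n=1,2,\ldots$; $\mathbb{U}_{m\text{-ultra}}$ denotes the set of $m$-ultra numbers. *)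

theory Defs
  imports "HOL-Analysis.Analysis" "HOL-Computational_Algebra.Computational_Algebra"
begin

definition real_analytic :: "(real \<Rightarrow> real) \<Rightarrow> bool" where
  "real_analytic f \<longleftrightarrow> (\<forall>x. \<exists>F. (\<lambda>h. f (x + h)) has_fps_expansion F)"

text \<open>
  A polynomial $P(x,y)$ over the complex numbers is represented as a polynomial in $y$ whose
  coefficients are polynomials in $x$.
\<close>

definition eval_poly2 :: "complex poly poly \<Rightarrow> complex \<Rightarrow> complex \<Rightarrow> complex" where
  "eval_poly2 P x y = poly (poly P [:y:]) x"

lemma eval_poly2_altdef:
  "eval_poly2 P x y = (\<Sum>j\<le>degree P. \<Sum>i\<le>degree (coeff P j). coeff (coeff P j) i * x ^ i * y ^ j)"
  by (simp add: eval_poly2_def poly_altdef[of P] poly_sum poly_altdef[of "coeff P _"]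
      sum_distrib_right flip: poly_const_pow)

definition transcendental_fun :: "(real \<Rightarrow> real) \<Rightarrow> bool" where
  "transcendental_fun f \<longleftrightarrow>
     (\<forall>P. (\<forall>x. eval_poly2 P (complex_of_real x) (complex_of_real (f x)) = 0) \<longrightarrow> P = 0)"

definition liouville_numbers :: "real set" where
  "liouville_numbers = {\<xi>. \<exists>p q :: nat \<Rightarrow> int. \<forall>k\<ge>1. q k > 1 \<and>
     0 < \<bar>\<xi> - of_int (p k) / of_int (q k)\<bar> \<and>
     \<bar>\<xi> - of_int (p k) / of_int (q k)\<bar> < 1 / of_int (q k) ^ k}"

text \<open>
  The primitive minimal polynomial over the integers is determined only up to sign; the
  representative with positive leading coefficient is used. Degree and height do not depend on
  this choice.
\<close>

definition is_int_minpoly :: "'a :: field_char_0 \<Rightarrow> int poly \<Rightarrow> bool" where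
  "is_int_minpoly a p \<longleftrightarrow>
     content p = 1 \<and> lead_coeff p > 0 \<and> poly (map_poly of_int p) a = 0 \<and>
     (\<forall>q. q \<noteq> 0 \<longrightarrow> poly (map_poly of_int q) a = 0 \<longrightarrow> degree p \<le> degree q)"

definition int_minpoly :: "'a :: field_char_0 \<Rightarrow> int poly" where
  "int_minpoly a = (THE p. is_int_minpoly a p)"

definition alg_degree :: "'a :: field_char_0 \<Rightarrow> nat" where
  "alg_degree a = degree (int_minpoly a)"

definition alg_height :: "'a :: field_char_0 \<Rightarrow> int" where
  "alg_height a = Max ((\<lambda>i. \<bar>coeff (int_minpoly a) i\<bar>) ` {..degree (int_minpoly a)})"

lemma map_poly_of_int_smult:
  "map_poly of_int (smult c p) = smult (of_int c) (map_poly of_int p :: 'a :: field_char_0 poly)"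
  by (rule poly_eqI) (simp add: coeff_map_poly)

lemma map_poly_of_int_diff:
  "map_poly of_int (p - q) = (map_poly of_int p - map_poly of_int q :: 'a :: field_char_0 poly)"
  by (rule poly_eqI) (simp add: coeff_map_poly)

lemma is_int_minpoly_exists:
  fixes a :: "'a :: field_char_0"
  assumes "algebraic a"
  shows "\<exists>p. is_int_minpoly a p"
proof -
  define S where "S = (\<lambda>p :: int poly. p \<noteq> 0 \<and> poly (map_poly of_int p) a = 0)"
  from assms obtain p0 where "S p0"
    unfolding S_def by (elim algebraicE') auto
  then obtain r where r: "S r" and r_min: "\<And>q. S q \<Longrightarrow> degree r \<le> degree q"
    by (metis arg_min_nat_lemma)
  define s where "s = primitive_part r"
  have s: "s \<noteq> 0" "content s = 1" "degree s = degree r"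
    using r by (auto simp: s_def S_def)
  have "poly (map_poly of_int (smult (content r) s)) a = 0"
    using r by (simp add: s_def S_def)
  then have root: "poly (map_poly of_int s) a = 0"
    using r by (simp add: map_poly_of_int_smult S_def)
  define c where "c = sgn (lead_coeff s)"
  have "lead_coeff s \<noteq> 0"
    using \<open>s \<noteq> 0\<close> by simp
  then have c: "\<bar>c\<bar> = 1" "c * lead_coeff s > 0"
    unfolding c_def by (auto simp: sgn_if simp del: leading_coeff_0_iff)
  have "is_int_minpoly a (smult c s)"
    using c s root r_min by (auto simp: is_int_minpoly_def S_def map_poly_of_int_smult)
  then show ?thesis ..
qed

lemma is_int_minpoly_unique:
  fixes a :: "'a :: field_char_0"
  assumes p: "is_int_minpoly a p" and q: "is_int_minpoly a q"
  shows "p = q"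
proof -
  have nz: "p \<noteq> 0" "q \<noteq> 0"
    using p q by (auto simp: is_int_minpoly_def)
  have deg: "degree p = degree q"
    using p q nz by (intro antisym) (auto simp: is_int_minpoly_def)
  define d where "d = smult (lead_coeff q) p - smult (lead_coeff p) q"
  have root: "poly (map_poly of_int d) a = 0"
    using p q by (simp add: d_def is_int_minpoly_def map_poly_of_int_smult map_poly_of_int_diff)
  have d0: "d = 0"
  proof (rule ccontr)
    assume "d \<noteq> 0"
    then have le: "degree p \<le> degree d"
      using p root by (simp add: is_int_minpoly_def)
    have "degree d \<le> degree p"
      unfolding d_def using deg by (intro degree_diff_le) (auto simp: degree_smult_le)
    moreover have "coeff d (degree p) = 0"
      using deg by (simp add: d_def mult.commute)
    ultimately show False
      using le \<open>d \<noteq> 0\<close> by (metis antisym leading_coeff_0_iff)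
  qed
  then have eq: "smult (lead_coeff q) p = smult (lead_coeff p) q"
    by (simp add: d_def)
  then have "content (smult (lead_coeff q) p) = content (smult (lead_coeff p) q)"
    by simp
  then have "lead_coeff q = lead_coeff p"
    using p q by (simp add: is_int_minpoly_def)
  with eq have "lead_coeff p * coeff p i = lead_coeff p * coeff q i" for i
    by (metis coeff_smult)
  with nz show ?thesis
    by (intro poly_eqI) simp
qed

lemma is_int_minpoly_int_minpoly:
  "algebraic a \<Longrightarrow> is_int_minpoly a (int_minpoly a)"
  unfolding int_minpoly_def
  by (rule theI') (use is_int_minpoly_exists is_int_minpoly_unique in blast)

definition exp3 :: "real \<Rightarrow> real" where
  "exp3 x = exp (exp (exp x))"

definition ultra_numbers :: "nat \<Rightarrow> real set" where
  "ultra_numbers m = {\<xi>. \<exists>\<alpha> :: nat \<Rightarrow> real. infinite (\<alpha> ` {1..}) \<and>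
     (\<forall>n\<ge>1. algebraic (\<alpha> n) \<and> alg_degree (\<alpha> n) = m \<and>
        0 < \<bar>\<xi> - \<alpha> n\<bar> \<and> \<bar>\<xi> - \<alpha> n\<bar> < 1 / exp3 (of_int (alg_height (\<alpha> n))) ^ n)}"

end

theory Submission
  imports Defs "HOL-Complex_Analysis.Complex_Analysis" "HOL-Real_Asymp.Real_Asymp"
begin

text \<open>
  Enumerate the real algebraic numbers of degree at most \<open>m\<close> by increasing height as
  \<open>a 0\<close>, \<open>a 1\<close>, ..., and consider the entire functions
  \<open>\<phi>(z) = (\<Sum>n. c n * (\<Prod>k<n. (z - a k)\<^sup>2))\<close> with small positive coefficients. The value at \<open>a n\<close> depends
  only on \<open>c 0\<close>, ..., \<open>c n\<close>, so \<open>c n\<close> can be adjusted, in two ways at each step, so that \<open>\<phi>(a n)\<close> is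
  rational. The denominator needed is governed by the distances \<open>\<bar>a n - a k\<bar>\<close>, which are bounded
  below by a power of the height, and by the index \<open>n\<close>, which is at most polynomial in the height; hence
  it is eventually below \<open>exp3\<close> of the height. If \<open>\<alpha>\<close> approximates \<open>\<xi>\<close> to order \<open>exp3(H(\<alpha>))\<^sup>-\<^sup>n\<close>, then
  \<open>\<phi>(\<alpha>)\<close> approximates \<open>\<phi>(\<xi>)\<close> as a Liouville number requires, and \<open>\<phi>(\<alpha>) \<noteq> \<phi>(\<xi>)\<close> because zeros are
  isolated. As \<open>\<phi>\<close> dominates each of its terms on the real line, it grows faster than every
  polynomial, so it is transcendental.
\<close>

section \<open>Separation of algebraic numbers\<close>

abbreviation ipoly_eval :: "int poly \<Rightarrow> real \<Rightarrow> real" where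
  "ipoly_eval p x \<equiv> poly (map_poly of_int p) x"

lemma ipoly_eval_altdef: "ipoly_eval p x = (\<Sum>i\<le>degree p. of_int (coeff p i) * x ^ i)"
  by (simp add: poly_altdef coeff_map_poly degree_map_poly)

lemma map_poly_of_int_mult:
  "map_poly of_int (p * q) = (map_poly of_int p * map_poly of_int q :: 'a :: field_char_0 poly)"
  by (rule poly_eqI) (simp add: coeff_map_poly coeff_mult)

lemma map_poly_of_int_pderiv:
  "map_poly of_int (pderiv p) = (pderiv (map_poly of_int p) :: 'a :: field_char_0 poly)"
  by (rule poly_eqI) (simp add: coeff_map_poly coeff_pderiv)

lemma map_poly_of_int_monom:
  "map_poly of_int (monom c n) = (monom (of_int c) n :: 'a :: field_char_0 poly)"
  by (rule poly_eqI) (simp add: coeff_map_poly)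

section \<open>Coprime integer polynomials and the Euclidean algorithm\<close>

definition coeffs_bounded :: "int poly \<Rightarrow> real \<Rightarrow> bool" where
  "coeffs_bounded p K \<longleftrightarrow> (\<forall>i. \<bar>of_int (coeff p i)\<bar> \<le> K)"

text \<open>This is coprimality over the rationals expressed with integer polynomials: the nonzero
  multipliers \<open>u\<close> and \<open>v\<close> clear the denominators of rational
  division.\<close>

definition no_common_factor :: "int poly \<Rightarrow> int poly \<Rightarrow> bool" where
  "no_common_factor A B \<longleftrightarrow>
     (\<forall>G u v. u \<noteq> 0 \<longrightarrow> v \<noteq> 0 \<longrightarrow> G dvd smult u A \<longrightarrow> G dvd smult v B \<longrightarrow> degree G = 0)"

lemma no_common_factor_commute: "no_common_factor A B \<longleftrightarrow> no_common_factor B A"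
  unfolding no_common_factor_def by blast

lemma no_common_factor_0_left:
  assumes "no_common_factor 0 B"
  shows "degree B = 0" "B \<noteq> 0"
proof -
  show "degree B = 0"
    using assms unfolding no_common_factor_def
    by (metis dvd_0_right dvd_refl one_neq_zero smult_1_left smult_0_right)
  show "B \<noteq> 0"
  proof
    assume "B = 0"
    then have "degree (monom 1 1 :: int poly) = 0"
      using assms unfolding no_common_factor_def by (metis dvd_0_right smult_0_right zero_neq_one)
    then show False by (simp add: degree_monom_eq)
  qed
qed

text \<open>A divisor of both \<open>smult u A\<close> and
  \<open>smult v (smult c B - Q * A)\<close> also divides \<open>smult (u * v * c) B\<close>, and
  \<open>u * v * c\<close> is again a nonzero multiplier.\<close>

lemma no_common_factor_step:
  assumes "no_common_factor A B" "c \<noteq> 0"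
  shows "no_common_factor A (smult c B - Q * A)"
  unfolding no_common_factor_def
proof (intro allI impI)
  fix G u v
  assume *: "u \<noteq> 0" "v \<noteq> 0" "G dvd smult u A" "G dvd smult v (smult c B - Q * A)"
  have "G dvd smult u (smult v (smult c B - Q * A)) + smult v Q * smult u A"
    using * by (metis dvd_add dvd_mult dvd_smult)
  also have "smult u (smult v (smult c B - Q * A)) + smult v Q * smult u A = smult (u * v * c) B"
    by (simp add: smult_diff_right mult_ac)
  finally show "degree G = 0"
    using assms * unfolding no_common_factor_def
    by (metis mult_eq_0_iff)
qed

text \<open>The recursion follows the induction for the lower bound: cubing \<open>X\<close> triples
  the exponent, and \<open>X ^ (s + 3)\<close> pays for the multipliers that express the new
  remainder through the two old polynomials.\<close>

fun euclid_exponent :: "nat \<Rightarrow> nat" where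
  "euclid_exponent 0 = 0"
| "euclid_exponent (Suc s) = 3 * euclid_exponent s + s + 3"

lemma nonzero_const_abs_ge_1:
  assumes "degree A = 0" "A \<noteq> 0"
  shows "1 \<le> \<bar>ipoly_eval A x\<bar>"
proof -
  from assms obtain a where a: "A = [:a:]" "a \<noteq> 0"
    by (metis degree_eq_zeroE pCons_0_0)
  then have "1 \<le> \<bar>of_int a :: real\<bar>" by linarith
  with a show ?thesis by (simp add: map_poly_pCons)
qed

lemma coeffs_bounded_mono: "coeffs_bounded p K \<Longrightarrow> K \<le> K' \<Longrightarrow> coeffs_bounded p K'"
  unfolding coeffs_bounded_def by (meson order_trans)

text \<open>
  The step of the Euclidean algorithm that cancels the leading term of the polynomial of larger
  degree replaces a bound \<open>X\<close> on the coefficients by \<open>X\<^sup>3\<close>, so a sum of degrees \<open>s\<close> allows \<open>s\<close> steps.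
\<close>

lemma euclid_lower_bound:
  assumes "no_common_factor A B" "coeffs_bounded A X" "coeffs_bounded B X" "2 \<le> X" "\<bar>x\<bar> \<le> X"
    and "degree A + degree B \<le> s"
  shows "1 \<le> X ^ euclid_exponent s * (\<bar>ipoly_eval A x\<bar> + \<bar>ipoly_eval B x\<bar>)"
  using assms
proof (induction s arbitrary: A B X)
  case 0
  then have deg: "degree A = 0" "degree B = 0" by auto
  then have "A \<noteq> 0 \<or> B \<noteq> 0"
    using no_common_factor_0_left(2) 0 by blast
  then show ?case
    using nonzero_const_abs_ge_1[of A x] nonzero_const_abs_ge_1[of B x] deg by auto
next
  case (Suc s)
  have X1: "1 \<le> X ^ n" for n using Suc.prems by (simp add: one_le_power)
  have const: ?case if "(degree A = 0 \<and> A \<noteq> 0) \<or> (degree B = 0 \<and> B \<noteq> 0)"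
  proof -
    have "1 \<le> \<bar>ipoly_eval A x\<bar> + \<bar>ipoly_eval B x\<bar>"
      using that nonzero_const_abs_ge_1[of A x] nonzero_const_abs_ge_1[of B x] by fastforce
    then show ?thesis
      using mult_mono[OF X1[of "euclid_exponent (Suc s)"], of 1 "\<bar>ipoly_eval A x\<bar> + \<bar>ipoly_eval B x\<bar>"] Suc.prems by simp
  qed
  \<comment> \<open>Stated for fresh \<open>A\<close> and \<open>B\<close>, so that it can be
    applied in either order according to which degree is larger.\<close>
  have main: "1 \<le> X ^ euclid_exponent (Suc s) * (\<bar>ipoly_eval A x\<bar> + \<bar>ipoly_eval B x\<bar>)"
    if hyp: "no_common_factor A B" "coeffs_bounded A X" "coeffs_bounded B X" 
      "degree A + degree B \<le> Suc s" "degree A \<ge> 1" "degree A \<le> degree B" for A B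
  proof -
    define k where "k = degree B - degree A"
    define B' where "B' = smult (lead_coeff A) B - monom (lead_coeff B) k * A"
    have [simp]: "lead_coeff A \<noteq> 0" using hyp by auto
    have ncf: "no_common_factor A B'"
      unfolding B'_def by (rule no_common_factor_step) (use hyp in auto)
    have cf: "coeff B' i = lead_coeff A * coeff B i - (if i \<ge> k then lead_coeff B * coeff A (i - k) else 0)" for i
      by (simp add: B'_def coeff_monom_mult)
    have "degree B' < degree B"
    proof -
      have "coeff B' i = 0" if "i \<ge> degree B" for i
        using that hyp by (cases "i = degree B") (auto simp: cf k_def coeff_eq_0)
      then have "degree B' \<le> degree B - 1"
        by (intro degree_le) auto
      then show ?thesis using hyp by linarith
    qed
    then have deg: "degree A + degree B' \<le> s" using hyp by linarith
    have abs_bd: "\<bar>of_int (coeff A i)\<bar> \<le> X" "\<bar>of_int (coeff B i)\<bar> \<le> X" for i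
      using hyp unfolding coeffs_bounded_def by auto
    have X3: "X\<^sup>2 + X\<^sup>2 \<le> X ^ 3" 
      using mult_right_mono[of 2 X "X\<^sup>2"] Suc.prems by (simp add: power3_eq_cube power2_eq_square)
    have XX3: "X \<le> X ^ 3" using Suc.prems self_le_power[of X 3] by simp
    have cb: "coeffs_bounded B' (X ^ 3)"
      unfolding coeffs_bounded_def
    proof
      fix i
      have 1: "\<bar>of_int (lead_coeff A) * of_int (coeff B i)\<bar> \<le> X\<^sup>2"
        unfolding abs_mult power2_eq_square using abs_bd Suc.prems by (intro mult_mono) auto
      have 2: "\<bar>of_int (lead_coeff B) * of_int (coeff A (i - k))\<bar> \<le> X\<^sup>2"
        unfolding abs_mult power2_eq_square using abs_bd Suc.prems by (intro mult_mono) auto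
      have "\<bar>of_int (coeff B' i)\<bar> \<le> X\<^sup>2 + X\<^sup>2"
        using 1 2 by (auto simp: cf)
      with X3 show "\<bar>of_int (coeff B' i)\<bar> \<le> X ^ 3" by linarith
    qed
    have IH: "1 \<le> (X ^ 3) ^ euclid_exponent s * (\<bar>ipoly_eval A x\<bar> + \<bar>ipoly_eval B' x\<bar>)"
      using Suc.prems XX3 by (intro Suc.IH ncf cb deg coeffs_bounded_mono[OF hyp(2)]) auto
    have "ipoly_eval B' x = of_int (lead_coeff A) * ipoly_eval B x - of_int (lead_coeff B) * x ^ k * ipoly_eval A x"
      by (simp add: B'_def map_poly_of_int_diff map_poly_of_int_mult map_poly_of_int_smult 
          map_poly_of_int_monom poly_monom)
    then have "\<bar>ipoly_eval B' x\<bar> \<le> \<bar>of_int (lead_coeff A)\<bar> * \<bar>ipoly_eval B x\<bar> + \<bar>of_int (lead_coeff B)\<bar> * \<bar>x\<bar> ^ k * \<bar>ipoly_eval A x\<bar>"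
      by (metis abs_mult abs_triangle_ineq4 power_abs)
    also have "\<dots> \<le> X * \<bar>ipoly_eval B x\<bar> + X * X ^ k * \<bar>ipoly_eval A x\<bar>"
      using Suc.prems abs_bd by (intro add_mono mult_mono power_mono) auto
    finally have B': "\<bar>ipoly_eval B' x\<bar> \<le> X * \<bar>ipoly_eval B x\<bar> + X ^ Suc k * \<bar>ipoly_eval A x\<bar>" by simp
    \<comment> \<open>As \<open>degree A\<close> is at least 1 and the degrees sum to at most
      \<open>Suc s\<close>, \<open>k\<close> does not exceed \<open>s\<close>; hence all multipliers
      fit under \<open>X ^ (s + 3)\<close>.\<close>
    have "1 + X ^ Suc k \<le> X ^ Suc (Suc k)"
    proof -
      have "1 + X ^ Suc k \<le> 2 * X ^ Suc k" using X1[of "Suc k"] by linarith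
      also have "\<dots> \<le> X * X ^ Suc k" using Suc.prems X1[of "Suc k"] by (intro mult_right_mono) auto
      finally show ?thesis by simp
    qed
    also have "X ^ Suc (Suc k) \<le> X ^ (s + 3)"
      using Suc.prems hyp by (intro power_increasing) (auto simp: k_def)
    finally have kk: "1 + X ^ Suc k \<le> X ^ (s + 3)" .
    have "X \<le> X ^ (s + 3)" using Suc.prems by (intro self_le_power) auto
    have "\<bar>ipoly_eval A x\<bar> + \<bar>ipoly_eval B' x\<bar> \<le> X ^ (s + 3) * \<bar>ipoly_eval A x\<bar> + X ^ (s + 3) * \<bar>ipoly_eval B x\<bar>"
      using B' mult_right_mono[OF kk abs_ge_zero, of "ipoly_eval A x"] mult_right_mono[OF \<open>X \<le> X ^ (s + 3)\<close> abs_ge_zero, of "ipoly_eval B x"]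
      by (simp only: distrib_right mult_1_left)
    then have "(X ^ 3) ^ euclid_exponent s * (\<bar>ipoly_eval A x\<bar> + \<bar>ipoly_eval B' x\<bar>) \<le>
        (X ^ 3) ^ euclid_exponent s * (X ^ (s + 3) * (\<bar>ipoly_eval A x\<bar> + \<bar>ipoly_eval B x\<bar>))"
      using Suc.prems by (intro mult_left_mono) (auto simp: distrib_left)
    also have "\<dots> = X ^ euclid_exponent (Suc s) * (\<bar>ipoly_eval A x\<bar> + \<bar>ipoly_eval B x\<bar>)"
      by (simp only: euclid_exponent.simps power_mult[symmetric] power_add[symmetric] mult.assoc[symmetric] add.assoc)
    finally show ?thesis using IH by linarith
  qed
  show ?case
  proof (cases "(degree A = 0 \<and> A \<noteq> 0) \<or> (degree B = 0 \<and> B \<noteq> 0)")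
    case False
    then have "A \<noteq> 0" "B \<noteq> 0"
      using no_common_factor_0_left[of A] no_common_factor_0_left[of B] Suc.prems(1)
      by (auto simp: no_common_factor_commute)
    with False have "degree A \<ge> 1" "degree B \<ge> 1" by auto
    then show ?thesis
      using main[of A B] main[of B A] Suc.prems
      by (cases "degree A \<le> degree B") (auto simp: no_common_factor_commute add.commute)
  qed (use const in auto)
qed

section \<open>Minimal polynomials over the integers\<close>

lemma int_minpoly_facts:
  fixes a :: "'a :: field_char_0"
  assumes "algebraic a"
  shows poly_int_minpoly: "poly (map_poly of_int (int_minpoly a)) a = 0"
    and lead_coeff_int_minpoly: "lead_coeff (int_minpoly a) > 0"
    and degree_int_minpoly_le: "q \<noteq> 0 \<Longrightarrow> poly (map_poly of_int q) a = 0 \<Longrightarrow> alg_degree a \<le> degree q"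
  using is_int_minpoly_int_minpoly[OF assms] unfolding is_int_minpoly_def alg_degree_def by blast+

lemma int_minpoly_nonzero: "algebraic a \<Longrightarrow> int_minpoly a \<noteq> 0"
  using lead_coeff_int_minpoly by fastforce

lemma alg_degree_pos:
  fixes a :: real
  assumes "algebraic a"
  shows "alg_degree a > 0"
proof (rule ccontr)
  assume "\<not> ?thesis"
  then show False
    using nonzero_const_abs_ge_1[of "int_minpoly a" a] int_minpoly_nonzero[OF assms] poly_int_minpoly[OF assms]
    by (simp add: alg_degree_def)
qed

text \<open>A common divisor \<open>G\<close> of positive degree cannot vanish at \<open>a\<close>,
  because \<open>B\<close> does not. So the cofactor \<open>h\<close> vanishes there, although its
  degree is below that of the minimal polynomial.\<close>

lemma no_common_factor_int_minpoly:
  fixes a :: real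
  assumes a: "algebraic a" and B: "ipoly_eval B a \<noteq> 0"
  shows "no_common_factor (int_minpoly a) B"
  unfolding no_common_factor_def
proof (intro allI impI, rule ccontr)
  fix G u v
  assume *: "u \<noteq> 0" "v \<noteq> 0" "G dvd smult u (int_minpoly a)" "G dvd smult v B" "degree G \<noteq> 0"
  from * obtain h where h: "smult u (int_minpoly a) = G * h" by (auto elim: dvdE)
  from * obtain k where k: "smult v B = G * k" by (auto elim: dvdE)
  have "ipoly_eval G a * ipoly_eval k a = of_int v * ipoly_eval B a"
    by (metis k map_poly_of_int_mult map_poly_of_int_smult poly_mult poly_smult)
  with B * have "ipoly_eval G a \<noteq> 0" by auto
  moreover have "ipoly_eval G a * ipoly_eval h a = of_int u * ipoly_eval (int_minpoly a) a"
    by (metis h map_poly_of_int_mult map_poly_of_int_smult poly_mult poly_smult)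
  ultimately have ha: "ipoly_eval h a = 0"
    by (simp add: poly_int_minpoly[OF a])
  have "G \<noteq> 0" "h \<noteq> 0"
    using h *(1) int_minpoly_nonzero[OF a] by auto
  then have "alg_degree a \<le> degree h" using degree_int_minpoly_le[OF a] ha by blast
  moreover have "alg_degree a = degree G + degree h"
    using arg_cong[OF h, of degree] * \<open>G \<noteq> 0\<close> \<open>h \<noteq> 0\<close> by (simp add: alg_degree_def degree_mult_eq)
  ultimately show False using * by simp
qed

section \<open>Size, Lipschitz and root bounds for integer polynomials\<close>

lemma abs_ipoly_eval_le:
  assumes p: "coeffs_bounded p K" "degree p \<le> m" and x: "\<bar>x\<bar> \<le> Y" "1 \<le> Y"
  shows "\<bar>ipoly_eval p x\<bar> \<le> real (m + 1) * K * Y ^ m"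
proof -
  have K: "0 \<le> K" using p(1) unfolding coeffs_bounded_def by (meson abs_ge_zero order_trans)
  have "\<bar>ipoly_eval p x\<bar> \<le> (\<Sum>i\<le>degree p. \<bar>of_int (coeff p i) * x ^ i\<bar>)"
    unfolding ipoly_eval_altdef by (rule sum_abs)
  also have "\<dots> \<le> (\<Sum>i\<le>degree p. K * Y ^ m)"
  proof (intro sum_mono)
    fix i assume "i \<in> {..degree p}"
    then have "\<bar>x\<bar> ^ i \<le> Y ^ m"
      using x p by (intro order_trans[OF power_mono[of "\<bar>x\<bar>" Y i]] power_increasing) auto
    then show "\<bar>of_int (coeff p i) * x ^ i\<bar> \<le> K * Y ^ m"
      using p(1) K unfolding abs_mult power_abs coeffs_bounded_def by (intro mult_mono) auto
  qed
  also have "\<dots> = real (degree p + 1) * (K * Y ^ m)" by simp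
  also have "\<dots> \<le> real (m + 1) * (K * Y ^ m)"
    using p K x by (intro mult_right_mono) auto
  finally show ?thesis by (simp add: mult.assoc)
qed

lemma coeffs_bounded_pderiv:
  assumes "coeffs_bounded p K" "degree p \<le> m"
  shows "coeffs_bounded (pderiv p) (real m * K)"
  unfolding coeffs_bounded_def
proof
  fix i
  have K: "0 \<le> K" using assms(1) unfolding coeffs_bounded_def by (meson abs_ge_zero order_trans)
  show "\<bar>of_int (coeff (pderiv p) i)\<bar> \<le> real m * K"
  proof (cases "Suc i \<le> m")
    case True
    have "\<bar>of_int (coeff (pderiv p) i)\<bar> = real (Suc i) * \<bar>of_int (coeff p (Suc i))\<bar>"
      by (simp add: coeff_pderiv abs_mult)
    also have "\<dots> \<le> real m * K"
      using True assms(1) K unfolding coeffs_bounded_def by (intro mult_mono) auto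
    finally show ?thesis .
  next
    case False
    then have "coeff p (Suc i) = 0" using assms(2) by (intro coeff_eq_0) auto
    then show ?thesis using K by (simp add: coeff_pderiv)
  qed
qed

text \<open>Mean value theorem. Three of the factors \<open>Y\<close> cover the number of terms, the
  factor \<open>m\<close> from differentiation and the coefficients; the other \<open>m\<close>
  bound the powers of the variable.\<close>

lemma abs_ipoly_eval_diff_le:
  assumes p: "coeffs_bounded p Y" "degree p \<le> m" and Y: "real m + 1 \<le> Y"
    and x: "\<bar>x\<bar> \<le> Y" "\<bar>y\<bar> \<le> Y"
  shows "\<bar>ipoly_eval p x - ipoly_eval p y\<bar> \<le> Y ^ (m + 3) * \<bar>x - y\<bar>"
proof -
  have *: "\<bar>ipoly_eval p x - ipoly_eval p y\<bar> \<le> Y ^ (m + 3) * \<bar>x - y\<bar>"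
    if x: "\<bar>x\<bar> \<le> Y" "\<bar>y\<bar> \<le> Y" "x < y" for x y
  proof -
    from poly_MVT[OF \<open>x < y\<close>, of "map_poly of_int p"] obtain c where c: "x < c" "c < y"
      "ipoly_eval p y - ipoly_eval p x = (y - x) * ipoly_eval (pderiv p) c"
      by (auto simp: map_poly_of_int_pderiv)
    have "\<bar>ipoly_eval (pderiv p) c\<bar> \<le> real (m + 1) * (real m * Y) * Y ^ m"
      using c x Y by (intro abs_ipoly_eval_le coeffs_bounded_pderiv p) (use p in \<open>auto simp: degree_pderiv\<close>)
    also have "\<dots> \<le> Y * (Y * Y) * Y ^ m"
      using Y by (intro mult_mono mult_nonneg_nonneg) auto
    also have "\<dots> = Y ^ (m + 3)" by (simp add: power_add power3_eq_cube)
    finally have d: "\<bar>ipoly_eval (pderiv p) c\<bar> \<le> Y ^ (m + 3)" .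
    have "\<bar>ipoly_eval p x - ipoly_eval p y\<bar> = \<bar>ipoly_eval (pderiv p) c\<bar> * \<bar>x - y\<bar>"
      using c by (metis abs_minus_commute abs_mult mult.commute)
    with d show ?thesis by (simp add: mult_right_mono)
  qed
  show ?thesis
    using *[of x y] *[of y x] x by (cases x y rule: linorder_cases) (auto simp: abs_minus_commute)
qed

text \<open>Cauchy's root bound: the leading coefficient is an integer of absolute value at least 1,
  so beyond \<open>K + 1\<close> the top term exceeds the geometric sum that bounds all the
  others.\<close>

lemma abs_algebraic_le:
  fixes a :: real
  assumes a: "algebraic a" and K: "coeffs_bounded (int_minpoly a) K"
  shows "\<bar>a\<bar> \<le> K + 1"
proof (rule ccontr)
  assume large: "\<not> \<bar>a\<bar> \<le> K + 1"
  define p where "p = int_minpoly a"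
  define d where "d = degree p"
  define t where "t = \<bar>a\<bar>"
  have cK: "\<bar>of_int (coeff p i)\<bar> \<le> K" for i using K by (simp add: coeffs_bounded_def p_def)
  have K0: "0 \<le> K" using cK[of 0] by linarith
  have t: "t > K + 1" using large by (simp add: t_def)
  have "0 = (\<Sum>i\<le>d. of_int (coeff p i) * a ^ i)"
    using poly_int_minpoly[OF a] by (simp add: ipoly_eval_altdef p_def d_def)
  also have "{..d} = insert d {..<d}" by auto
  finally have "of_int (coeff p d) * a ^ d = - (\<Sum>i<d. of_int (coeff p i) * a ^ i)" by simp
  then have "\<bar>of_int (coeff p d)\<bar> * t ^ d = \<bar>\<Sum>i<d. of_int (coeff p i) * a ^ i\<bar>"
    by (metis abs_minus_cancel abs_mult power_abs t_def)
  also have "\<dots> \<le> (\<Sum>i<d. \<bar>of_int (coeff p i) * a ^ i\<bar>)" by (rule sum_abs)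
  also have "\<dots> \<le> (\<Sum>i<d. K * t ^ i)"
    unfolding abs_mult power_abs t_def using cK by (intro sum_mono mult_right_mono) auto
  also have "\<dots> = K * (\<Sum>i<d. t ^ i)" by (simp add: sum_distrib_left)
  also have "\<dots> \<le> (t - 1) * (\<Sum>i<d. t ^ i)"
    using t K0 by (intro mult_right_mono sum_nonneg) auto
  also have "\<dots> = t ^ d - 1" by (simp add: power_diff_1_eq)
  finally have "\<bar>of_int (coeff p d)\<bar> * t ^ d \<le> t ^ d - 1" .
  moreover have "t ^ d \<le> \<bar>of_int (coeff p d)\<bar> * t ^ d"
  proof -
    have "1 \<le> \<bar>of_int (coeff p d) :: real\<bar>"
      using lead_coeff_int_minpoly[OF a] unfolding p_def[symmetric] d_def by linarith
    then show ?thesis using mult_right_mono[of 1 _ "t ^ d"] t K0 by simp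
  qed
  ultimately show False by linarith
qed

text \<open>The Euclidean bound is used for two polynomials of degree at most \<open>m\<close>, the
  summand \<open>m + 3\<close> comes from the Lipschitz bound, and the factor 2 from working with
  the square of \<open>X\<close>.\<close>

definition separation_exponent :: "nat \<Rightarrow> nat" where
  "separation_exponent m = 2 * (euclid_exponent (2 * m) + m + 3)"

text \<open>
  For conjugates \<open>a\<close>, \<open>b\<close> the minimal polynomial vanishes at both points, and Rolle's theorem moves the
  argument to its derivative.
\<close>

lemma algebraic_separation:
  fixes a b :: real
  assumes a: "algebraic a" "alg_degree a \<le> m" "coeffs_bounded (int_minpoly a) X"
    and b: "algebraic b" "alg_degree b \<le> m" "coeffs_bounded (int_minpoly b) X"
    and X: "real m + 2 \<le> X" and ab: "a \<noteq> b"
  shows "1 \<le> X ^ separation_exponent m * \<bar>a - b\<bar>"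
proof -
  \<comment> \<open>A single bound must serve the coefficients of the minimal polynomials, those of
    a derivative (at most \<open>m * X\<close>) and the points themselves (at most
    \<open>X + 1\<close>); the square of \<open>X\<close> exceeds all of these.\<close>
  define Y where "Y = X\<^sup>2"
  have XY: "2 * X \<le> Y" using X mult_right_mono[of 2 X X] by (simp add: Y_def power2_eq_square)
  have aY: "\<bar>a\<bar> \<le> Y" and bY: "\<bar>b\<bar> \<le> Y"
    using abs_algebraic_le[OF a(1,3)] abs_algebraic_le[OF b(1,3)] XY X by linarith+
  have Y2: "2 \<le> Y" "real m + 1 \<le> Y" "X \<le> Y" using X XY by linarith+
  define e where "e = euclid_exponent (2 * m)"
  have fin: ?thesis if "1 \<le> Y ^ e * t" "t \<le> Y ^ (m + 3) * \<bar>a - b\<bar>" for t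
  proof -
    have "Y ^ e * t \<le> Y ^ e * (Y ^ (m + 3) * \<bar>a - b\<bar>)"
      using that(2) Y2 by (intro mult_left_mono) auto
    also have "\<dots> = X ^ separation_exponent m * \<bar>a - b\<bar>"
      unfolding Y_def separation_exponent_def e_def
      by (simp only: power_mult[symmetric] power_add[symmetric] mult.assoc[symmetric] distrib_left add.assoc)
    finally show ?thesis using that(1) by linarith
  qed
  show ?thesis
  proof (cases "ipoly_eval (int_minpoly a) b = 0")
    case False
    \<comment> \<open>The minimal polynomial of \<open>b\<close> vanishes at \<open>b\<close>, so
      the lower bound falls on the value of the other polynomial alone, which is a difference of its
      values at \<open>a\<close> and \<open>b\<close>.\<close>
    have "1 \<le> Y ^ e * (\<bar>ipoly_eval (int_minpoly b) b\<bar> + \<bar>ipoly_eval (int_minpoly a) b\<bar>)"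
      unfolding e_def using Y2 bY a b False
      by (intro euclid_lower_bound no_common_factor_int_minpoly) (auto intro: coeffs_bounded_mono simp: alg_degree_def)
    then have "1 \<le> Y ^ e * \<bar>ipoly_eval (int_minpoly a) a - ipoly_eval (int_minpoly a) b\<bar>"
      by (simp add: poly_int_minpoly a b)
    then show ?thesis
      by (rule fin) (use Y2 aY bY a in \<open>auto intro!: abs_ipoly_eval_diff_le intro: coeffs_bounded_mono simp: alg_degree_def\<close>)
  next
    case True
    define A' where "A' = pderiv (int_minpoly a)"
    have A'_deg: "degree A' \<le> m" "degree A' < alg_degree a"
      using a alg_degree_pos[OF a(1)] unfolding A'_def by (auto simp: alg_degree_def degree_pderiv)
    have "A' \<noteq> 0"
      using alg_degree_pos[OF a(1)] by (auto simp: A'_def pderiv_eq_0_iff alg_degree_def)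
    then have A'a: "ipoly_eval A' a \<noteq> 0"
      using degree_int_minpoly_le[OF a(1), of A'] A'_deg by auto
    have cb: "coeffs_bounded A' Y"
    proof (rule coeffs_bounded_mono)
      show "coeffs_bounded A' (real m * X)"
        unfolding A'_def using a by (intro coeffs_bounded_pderiv) (auto simp: alg_degree_def)
      show "real m * X \<le> Y" using X by (auto simp: Y_def power2_eq_square intro!: mult_right_mono)
    qed
    have rolle: "\<exists>c. x < c \<and> c < y \<and> ipoly_eval A' c = 0"
      if "x < y" "ipoly_eval (int_minpoly a) x = 0" "ipoly_eval (int_minpoly a) y = 0" for x y
      using poly_MVT[OF that(1), of "map_poly of_int (int_minpoly a)"] that
      by (auto simp: A'_def map_poly_of_int_pderiv)
    have "\<exists>c. \<bar>c\<bar> \<le> Y \<and> \<bar>a - c\<bar> \<le> \<bar>a - b\<bar> \<and> ipoly_eval A' c = 0"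
    proof (cases "a < b")
      case True': True
      then obtain c where "a < c" "c < b" "ipoly_eval A' c = 0"
        using rolle[of a b] True poly_int_minpoly[OF a(1)] by auto
      then show ?thesis using aY bY by (intro exI[of _ c]) auto
    next
      case False
      then obtain c where "b < c" "c < a" "ipoly_eval A' c = 0"
        using rolle[of b a] True poly_int_minpoly[OF a(1)] ab by auto
      then show ?thesis using aY bY by (intro exI[of _ c]) auto
    qed
    then obtain c where c: "\<bar>c\<bar> \<le> Y" "\<bar>a - c\<bar> \<le> \<bar>a - b\<bar>" "ipoly_eval A' c = 0" by blast
    have "1 \<le> Y ^ e * (\<bar>ipoly_eval (int_minpoly a) a\<bar> + \<bar>ipoly_eval A' a\<bar>)"
      unfolding e_def using Y2 aY a A'a A'_deg cb
      by (intro euclid_lower_bound no_common_factor_int_minpoly) (auto intro: coeffs_bounded_mono simp: alg_degree_def)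
    then have "1 \<le> Y ^ e * \<bar>ipoly_eval A' a - ipoly_eval A' c\<bar>"
      by (simp add: poly_int_minpoly a c)
    moreover have "\<bar>ipoly_eval A' a - ipoly_eval A' c\<bar> \<le> Y ^ (m + 3) * \<bar>a - b\<bar>"
      using abs_ipoly_eval_diff_le[OF cb A'_deg(1) Y2(2) aY c(1)]
        mult_left_mono[OF c(2), of "Y ^ (m + 3)"] Y2 by (meson order_trans zero_le_power zero_le_numeral)
    ultimately show ?thesis by (rule fin)
  qed
qed

section \<open>Interpolation data\<close>

text \<open>A coefficient below this bound keeps the \<open>n\<close>-th term below \<open>1 / 2 ^ n\<close> on the disc of radius \<open>n\<close>.\<close>

definition coeff_bound :: "(nat \<Rightarrow> real) \<Rightarrow> nat \<Rightarrow> real" where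
  "coeff_bound a n = 1 / (2 ^ n * (\<Prod>k<n. (real n + \<bar>a k\<bar>)\<^sup>2))"

definition node_poly :: "(nat \<Rightarrow> 'a :: comm_ring_1) \<Rightarrow> nat \<Rightarrow> 'a \<Rightarrow> 'a" where
  "node_poly a n z = (\<Prod>k<n. (z - a k)\<^sup>2)"

text \<open>
  The values at \<open>a n\<close> that the \<open>n\<close>-th coefficient can reach form an interval of length
  \<open>coeff_bound a n * node_poly a n (a n)\<close>, which contains two multiples of \<open>1 / denominator a n\<close>.
\<close>

definition denominator :: "(nat \<Rightarrow> real) \<Rightarrow> nat \<Rightarrow> int" where
  "denominator a n = \<lceil>2 / (coeff_bound a n * node_poly a n (a n))\<rceil> + 1"

section \<open>Enumeration of algebraic numbers by height\<close>

lemma coeffs_bounded_int_minpoly: "coeffs_bounded (int_minpoly a) (of_int (alg_height a))"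
  unfolding coeffs_bounded_def
proof
  fix i
  have fin: "finite ((\<lambda>i. \<bar>coeff (int_minpoly a) i\<bar>) ` {..degree (int_minpoly a)})" by simp
  show "\<bar>of_int (coeff (int_minpoly a) i)\<bar> \<le> real_of_int (alg_height a)"
  proof (cases "i \<le> degree (int_minpoly a)")
    case True
    then have "\<bar>coeff (int_minpoly a) i\<bar> \<le> alg_height a"
      unfolding alg_height_def by (intro Max_ge fin) auto
    then show ?thesis by linarith
  next
    case False
    have "\<bar>coeff (int_minpoly a) 0\<bar> \<le> alg_height a"
      unfolding alg_height_def by (intro Max_ge fin) auto
    then have "0 \<le> alg_height a" by linarith
    with False show ?thesis by (simp add: coeff_eq_0)
  qed
qed

lemma alg_height_nonneg: "0 \<le> alg_height a"
  using coeffs_bounded_int_minpoly[of a] unfolding coeffs_bounded_def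
  by (metis abs_ge_zero of_int_0_le_iff order_trans)

section \<open>Counting algebraic numbers of bounded height\<close>

definition real_algebraic_le :: "nat \<Rightarrow> real set" where
  "real_algebraic_le m = {x. algebraic x \<and> alg_degree x \<le> m}"

text \<open>The integers suffice: each is a root of a linear polynomial.\<close>

lemma infinite_real_algebraic_le:
  assumes "m \<ge> 1"
  shows "infinite (real_algebraic_le m)"
proof -
  have "of_int j \<in> real_algebraic_le m" for j
  proof -
    have alg: "algebraic (of_int j :: real)" by (simp add: algebraic_of_int)
    have "poly (map_poly of_int [:-j, 1:]) (of_int j :: real) = 0" by (simp add: map_poly_pCons)
    then have "alg_degree (of_int j :: real) \<le> degree [:-j, 1:]"
      using degree_int_minpoly_le[OF alg, of "[:-j, 1:]"] by simp
    with assms alg show ?thesis by (simp add: real_algebraic_le_def)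
  qed
  then have "range (of_int :: int \<Rightarrow> real) \<subseteq> real_algebraic_le m" by auto
  moreover have "infinite (range (of_int :: int \<Rightarrow> real))"
    by (simp add: finite_image_iff inj_on_def infinite_UNIV_int)
  ultimately show ?thesis using finite_subset by blast
qed

text \<open>Such a polynomial is determined by a list of \<open>m + 1\<close> coefficients, each
  with \<open>2 * H + 1\<close> possible values.\<close>

lemma finite_card_int_polys:
  fixes H m :: nat
  defines "P \<equiv> {p :: int poly. degree p \<le> m \<and> (\<forall>i. \<bar>coeff p i\<bar> \<le> int H)}"
  shows "finite P" "card P \<le> (2 * H + 1) ^ (m + 1)"
proof -
  define Ls where "Ls = {xs. set xs \<subseteq> {-int H..int H} \<and> length xs = m + 1}"
  have fin: "finite Ls" unfolding Ls_def by (intro finite_lists_length_eq) auto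
  have card: "card Ls = (2 * H + 1) ^ (m + 1)"
  proof -
    have "card {-int H..int H} = 2 * H + 1" by simp
    then show ?thesis unfolding Ls_def by (simp add: card_lists_length_eq)
  qed
  have sub: "P \<subseteq> Poly ` Ls"
  proof
    fix p assume p: "p \<in> P"
    have "p = Poly (map (coeff p) [0..<m+1])"
      using p by (intro poly_eqI) (auto simp: P_def nth_default_def coeff_eq_0 simp del: upt_Suc)
    moreover have "map (coeff p) [0..<m+1] \<in> Ls"
    proof -
      have "coeff p j \<in> {-int H..int H}" for j
      proof -
        have "\<bar>coeff p j\<bar> \<le> int H" using p by (simp add: P_def)
        then show ?thesis by (simp add: abs_le_iff)
      qed
      then show ?thesis by (auto simp only: Ls_def mem_Collect_eq set_map length_map length_upt)
    qed
    ultimately show "p \<in> Poly ` Ls" by (rule image_eqI)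
  qed
  show "finite P" using sub fin finite_surj by blast
  have "card P \<le> card (Poly ` Ls)" using sub fin by (intro card_mono) auto
  also have "\<dots> \<le> card Ls" by (rule card_image_le[OF fin])
  finally show "card P \<le> (2 * H + 1) ^ (m + 1)" by (simp only: card)
qed

text \<open>Each such number is a root of one of the finitely many nonzero polynomials just counted,
  and each of these has at most \<open>m\<close> real roots. For fixed \<open>m\<close> the count is
  polynomial in \<open>H\<close>.\<close>

lemma finite_card_bounded_height:
  fixes H m :: nat
  defines "S \<equiv> {x \<in> real_algebraic_le m. alg_height x \<le> int H}"
  shows "finite S" "card S \<le> m * (2 * H + 1) ^ (m + 1)"
proof -
  define P where "P = {p :: int poly. degree p \<le> m \<and> (\<forall>i. \<bar>coeff p i\<bar> \<le> int H)}"
  define R where "R p = {x. ipoly_eval p x = 0}" for p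
  have nz: "map_poly of_int p \<noteq> (0 :: real poly)" if "p \<noteq> 0" for p :: "int poly"
    using that by (auto simp: poly_eq_iff coeff_map_poly)
  have R: "finite (R p)" "card (R p) \<le> m" if "p \<in> P - {0}" for p
  proof -
    show "finite (R p)" unfolding R_def using that nz by (intro poly_roots_finite) auto
    have "card (R p) \<le> degree (map_poly of_int p :: real poly)"
      unfolding R_def using that nz by (intro card_poly_roots_bound) auto
    also have "\<dots> \<le> m" using that by (simp add: P_def degree_map_poly)
    finally show "card (R p) \<le> m" .
  qed
  have finP: "finite (P - {0})" using finite_card_int_polys(1) unfolding P_def by blast
  have sub: "S \<subseteq> (\<Union>p\<in>P - {0}. R p)"
  proof
    fix x assume x: "x \<in> S"
    then have alg: "algebraic x" by (simp add: S_def real_algebraic_le_def)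
    have "\<bar>coeff (int_minpoly x) i\<bar> \<le> int H" for i
    proof -
      have "\<bar>coeff (int_minpoly x) i\<bar> \<le> alg_height x"
        using coeffs_bounded_int_minpoly[of x] unfolding coeffs_bounded_def
        by (simp only: of_int_abs[symmetric] of_int_le_iff)
      also have "\<dots> \<le> int H" using x by (simp add: S_def)
      finally show ?thesis .
    qed
    then have "int_minpoly x \<in> P - {0}"
      using x int_minpoly_nonzero[OF alg] by (auto simp: P_def S_def real_algebraic_le_def alg_degree_def)
    then show "x \<in> (\<Union>p\<in>P - {0}. R p)"
      using poly_int_minpoly[OF alg] by (auto simp: R_def)
  qed
  have fin: "finite (\<Union>p\<in>P - {0}. R p)" using finP R by blast
  show "finite S" using sub fin finite_subset by blast
  have "card S \<le> card (\<Union>p\<in>P - {0}. R p)" using sub fin by (rule card_mono[rotated])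
  also have "\<dots> \<le> (\<Sum>p\<in>P - {0}. card (R p))" by (rule card_UN_le[OF finP])
  also have "\<dots> \<le> card (P - {0}) * m" using sum_bounded_above[of "P - {0}" "\<lambda>p. card (R p)" m] R by simp
  also have "\<dots> \<le> (2 * H + 1) ^ (m + 1) * m"
  proof (rule mult_right_mono)
    have "card (P - {0}) \<le> card P" using finite_card_int_polys(1) unfolding P_def by (intro card_mono) auto
    also have "\<dots> \<le> (2 * H + 1) ^ (m + 1)" using finite_card_int_polys(2) unfolding P_def .
    finally show "card (P - {0}) \<le> (2 * H + 1) ^ (m + 1)" .
  qed simp
  finally show "card S \<le> m * (2 * H + 1) ^ (m + 1)" by (simp only: mult.commute)
qed

lemma enumerate_by_rank:
  fixes ht :: "'a \<Rightarrow> 'b :: linorder"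
  assumes inf: "infinite S" and fin: "\<And>h. finite {x \<in> S. ht x \<le> h}"
  obtains a :: "nat \<Rightarrow> 'a" where "inj a" "range a = S" "\<And>k n. k \<le> n \<Longrightarrow> ht (a k) \<le> ht (a n)"
proof -
  define Q where "Q = (\<lambda>(f :: nat \<Rightarrow> 'a) n x. x \<in> S - f ` {..<n} \<and> (\<forall>y\<in>S - f ` {..<n}. ht x \<le> ht y))"
  have "\<exists>a. \<forall>n. Q a n (a n)"
  proof (rule dependent_wf_choice[OF wf_less])
    fix f g :: "nat \<Rightarrow> 'a" and n x
    assume "\<And>z. (z, n) \<in> {(x, y). x < y} \<Longrightarrow> f z = g z"
    then have "f ` {..<n} = g ` {..<n}" by (intro image_cong) auto
    then show "Q f n x = Q g n x" by (simp add: Q_def)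
  next
    fix n :: nat and f :: "nat \<Rightarrow> 'a"
    have "infinite (S - f ` {..<n})" using inf by simp
    then obtain z where z: "z \<in> S - f ` {..<n}" by (metis all_not_in_conv infinite_imp_nonempty)
    \<comment> \<open>Only elements no higher than \<open>z\<close> compete for the minimum, and
      these are finitely many.\<close>
    define T where "T = {y \<in> S - f ` {..<n}. ht y \<le> ht z}"
    have "finite T" by (rule finite_subset[OF _ fin[of "ht z"]]) (auto simp: T_def)
    moreover have "z \<in> T" using z by (simp add: T_def)
    ultimately obtain x where x: "x \<in> T" "\<And>y. y \<in> T \<Longrightarrow> ht x \<le> ht y"
      using arg_min_if_finite[of T ht] by (metis empty_iff linorder_not_less)
    have "Q f n x"
      unfolding Q_def
    proof safe
      show "x \<in> S" using x by (simp add: T_def)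
      fix y assume "y \<in> S" "y \<notin> f ` {..<n}"
      then show "ht x \<le> ht y" using x(2)[of y] x(2)[of z] \<open>z \<in> T\<close>
        by (cases "ht y \<le> ht z") (auto simp: T_def)
    qed (use x in \<open>auto simp: T_def\<close>)
    then show "\<exists>r. Q f n r" ..
  qed
  then obtain a where a: "\<And>n. Q a n (a n)" by blast
  have new: "a n \<in> S" "k < n \<Longrightarrow> a n \<noteq> a k" for n k
    using a[of n] by (auto simp: Q_def)
  have min: "ht (a n) \<le> ht y" if "y \<in> S" "\<And>k. k < n \<Longrightarrow> y \<noteq> a k" for n y
    using a[of n] that by (auto simp: Q_def)
  have inj: "inj a" using new(2) by (intro injI) (metis linorder_neqE_nat)
  have mono: "ht (a k) \<le> ht (a n)" if "k \<le> n" for k n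
    using min[of "a n" k] new that by fastforce
  have "S \<subseteq> range a"
  proof
    fix y assume y: "y \<in> S"
    show "y \<in> range a"
    proof (rule ccontr)
      assume "y \<notin> range a"
      then have "range a \<subseteq> {x \<in> S. ht x \<le> ht y}" using min[OF y] new(1) by auto
      then have "finite (range a)" using fin finite_subset by blast
      then show False using inj finite_imageD by blast
    qed
  qed
  with new(1) have "range a = S" by blast
  with inj mono show thesis using that by blast
qed

text \<open>With \<open>y = exp h\<close> the left-hand side is eventually at most
  \<open>y ^ (D + 2)\<close>, hence below \<open>exp y\<close>. Its shape is that of the exponent
  arising in the estimate of the denominators.\<close>

lemma eventually_poly_le_exp_exp:
  fixes m C D :: nat
  shows "eventually (\<lambda>h :: real. (h + m + 2) * (2 + C * (h + m + 2) ^ D) \<le> exp (exp h)) at_top"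
proof -
  have "eventually (\<lambda>y :: real. y ^ (D + 2) / exp y < 1) at_top"
    by (rule order_tendstoD(2)[OF tendsto_power_div_exp_0]) simp
  then have "eventually (\<lambda>h :: real. exp h ^ (D + 2) / exp (exp h) < 1) at_top"
    by (rule eventually_compose_filterlim[OF _ exp_at_top])
  moreover have "eventually (\<lambda>h :: real. h + m + 2 \<le> exp h) at_top" by real_asymp
  moreover have "eventually (\<lambda>h :: real. h \<ge> C + 2) at_top" by (rule eventually_ge_at_top)
  ultimately show ?thesis
  proof eventually_elim
    case (elim h)
    define X where "X = h + m + 2"
    have X: "X \<ge> real C + 2" "X \<le> exp h" using elim by (auto simp: X_def)
    have "X * (2 + C * X ^ D) \<le> X * (2 * X ^ D + C * X ^ D)"
      using X one_le_power[of X D] by (intro mult_left_mono add_mono) auto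
    also have "\<dots> = X * ((C + 2) * X ^ D)" by (simp add: algebra_simps)
    also have "\<dots> \<le> X * (X * X ^ D)"
      using X by (intro mult_left_mono mult_right_mono) auto
    also have "\<dots> = X ^ (D + 2)" by simp
    also have "\<dots> \<le> exp h ^ (D + 2)" using X by (intro power_mono) auto
    also have "\<dots> \<le> exp (exp h)" using elim by (simp add: divide_simps del: power_Suc)
    finally show ?case by (simp add: X_def)
  qed
qed

text \<open>With \<open>X\<close> linear in the height, the denominator is at most
  \<open>X ^ (2 + C * n)\<close> and \<open>n\<close> is polynomial in \<open>X\<close>. So its
  logarithm is bounded by a polynomial in the height, which \<open>exp (exp H)\<close> eventually
  exceeds.\<close>

lemma denominator_le_exp3:
  fixes a :: "nat \<Rightarrow> real"
  assumes m: "m \<ge> 1" and inj: "inj a" and ran: "range a \<subseteq> real_algebraic_le m"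
    and mono: "\<And>k n. k \<le> n \<Longrightarrow> alg_height (a k) \<le> alg_height (a n)"
  obtains H0 :: real where
    "\<And>n. H0 \<le> alg_height (a n) \<Longrightarrow> denominator a n \<le> exp3 (alg_height (a n))"
proof -
  \<comment> \<open>\<open>X ^ D\<close> will bound the index, \<open>X ^ E\<close> the inverse
    distances between nodes and \<open>X ^ F\<close> each squared quotient in the product; the extra
    1 in \<open>C\<close> accounts for the factor \<open>2 ^ n\<close>.\<close>
  define D where "D = 2 * m + 3"
  define E where "E = separation_exponent m"
  define F where "F = 2 * (D + 1 + E)"
  define C where "C = F + 1"
  obtain H0 :: real where H0: "\<And>h :: real. h \<ge> H0 \<Longrightarrow> (h + m + 2) * (2 + C * (h + m + 2) ^ D) \<le> exp (exp h)"
    using eventually_poly_le_exp_exp[of m C D] unfolding eventually_at_top_linorder by blast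
  show thesis
  proof (rule that[of H0])
    fix n
    assume n: "H0 \<le> alg_height (a n)"
    define H where "H = nat (alg_height (a n))"
    have H: "alg_height (a n) = int H" by (simp add: H_def alg_height_nonneg)
    define X where "X = real H + real m + 2"
    have X: "X \<ge> 3" "X \<ge> real m + 2" "X \<ge> real H + 1" using m by (auto simp: X_def)
    have alg: "algebraic (a k)" "alg_degree (a k) \<le> m" for k
      using ran by (auto simp: real_algebraic_le_def)
    have cb: "coeffs_bounded (int_minpoly (a k)) X" "\<bar>a k\<bar> \<le> X" if "k \<le> n" for k
    proof -
      have *: "coeffs_bounded (int_minpoly (a k)) (real H)"
        using mono[OF that] H by (intro coeffs_bounded_mono[OF coeffs_bounded_int_minpoly]) auto
      then show "coeffs_bounded (int_minpoly (a k)) X" by (rule coeffs_bounded_mono) (auto simp: X_def)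
      show "\<bar>a k\<bar> \<le> X" using abs_algebraic_le[OF alg(1) *] X by linarith
    qed
    \<comment> \<open>The \<open>n\<close> nodes before \<open>a n\<close> are distinct and of
      height at most \<open>H\<close>, so the counting lemma bounds \<open>n\<close>.\<close>
    have n_le: "real n \<le> X ^ D"
    proof -
      have "a ` {..<n} \<subseteq> {x \<in> real_algebraic_le m. alg_height x \<le> int H}"
      proof (rule image_subsetI)
        fix k assume "k \<in> {..<n}"
        then show "a k \<in> {x \<in> real_algebraic_le m. alg_height x \<le> int H}"
          using ran mono[of k n] H by auto
      qed
      then have "card (a ` {..<n}) \<le> m * (2 * H + 1) ^ (m + 1)"
        by (rule order_trans[OF card_mono[OF finite_card_bounded_height(1)] finite_card_bounded_height(2)])
      then have "n \<le> m * (2 * H + 1) ^ (m + 1)"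
        by (subst (asm) card_image) (use inj in \<open>auto simp: inj_on_def\<close>)
      then have "real n \<le> real (m * (2 * H + 1) ^ (m + 1))" by (simp only: of_nat_le_iff)
      also have "\<dots> = real m * (2 * real H + 1) ^ (m + 1)"
        by (simp only: of_nat_mult of_nat_power of_nat_add of_nat_numeral of_nat_1)
      also have "\<dots> \<le> X * (X\<^sup>2) ^ (m + 1)"
      proof (intro mult_mono power_mono)
        have "2 * real H + 1 \<le> 2 * X" using X by simp
        also have "\<dots> \<le> X\<^sup>2" using X by (simp add: power2_eq_square)
        finally show "2 * real H + 1 \<le> X\<^sup>2" .
      qed (use X in auto)
      also have "\<dots> = X ^ D" by (simp add: D_def power_add power_mult power3_eq_cube power2_eq_square)
      finally show ?thesis .
    qed
    have XD: "X \<le> X ^ D" using X by (intro self_le_power) (auto simp: D_def)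
    have factor: "(real n + \<bar>a k\<bar>)\<^sup>2 / (a n - a k)\<^sup>2 \<le> X ^ F" if "k < n" for k
    proof -
      have "real n + \<bar>a k\<bar> \<le> 2 * X ^ D" using n_le cb(2)[of k] that XD by linarith
      also have "\<dots> \<le> X * X ^ D" using X by (intro mult_right_mono) auto
      finally have 1: "real n + \<bar>a k\<bar> \<le> X ^ (D + 1)" by simp
      have ne: "a n \<noteq> a k" using inj that by (metis injD less_irrefl)
      have "1 \<le> X ^ E * \<bar>a n - a k\<bar>"
        unfolding E_def using X cb that ne by (intro algebraic_separation alg) auto
      then have "(real n + \<bar>a k\<bar>) / \<bar>a n - a k\<bar> \<le> X ^ E * (real n + \<bar>a k\<bar>)"
        using ne mult_right_mono[of 1 "X ^ E * \<bar>a n - a k\<bar>" "real n + \<bar>a k\<bar>"]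
        by (simp add: pos_divide_le_eq mult_ac)
      also have "\<dots> \<le> X ^ E * X ^ (D + 1)" using 1 X by (intro mult_left_mono) auto
      finally have "((real n + \<bar>a k\<bar>) / \<bar>a n - a k\<bar>)\<^sup>2 \<le> (X ^ E * X ^ (D + 1))\<^sup>2"
        by (intro power_mono) auto
      also have "(X ^ E * X ^ (D + 1))\<^sup>2 = X ^ F"
        unfolding F_def power_add[symmetric] power_mult[symmetric] by (simp only: add.commute mult.commute)
      finally show ?thesis by (simp add: power_divide)
    qed
    have "2 / (coeff_bound a n * node_poly a n (a n)) = 2 * (2 ^ n * (\<Prod>k<n. (real n + \<bar>a k\<bar>)\<^sup>2 / (a n - a k)\<^sup>2))"
      by (simp add: coeff_bound_def node_poly_def prod_dividef)
    also have "\<dots> \<le> X * (X ^ n * (\<Prod>k<n. X ^ F))"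
      using X by (intro mult_mono power_mono prod_mono conjI factor) (auto intro!: mult_nonneg_nonneg prod_nonneg)
    also have "\<dots> = X ^ (1 + C * n)"
      by (simp add: C_def power_add add_mult_distrib flip: power_mult)
    finally have L: "2 / (coeff_bound a n * node_poly a n (a n)) \<le> X ^ (1 + C * n)" .
    have "real_of_int (denominator a n) \<le> X ^ (1 + C * n) + 2"
      using L of_int_ceiling_le_add_one[of "2 / (coeff_bound a n * node_poly a n (a n))"]
      by (simp only: denominator_def of_int_add of_int_1)
    also have "\<dots> \<le> X * X ^ (1 + C * n)"
    proof -
      have 1: "1 \<le> X ^ (1 + C * n)" using X by (intro one_le_power) auto
      have "3 * X ^ (1 + C * n) \<le> X * X ^ (1 + C * n)"
        using X by (intro mult_right_mono zero_le_power) auto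
      with 1 show ?thesis by linarith
    qed
    finally have "real_of_int (denominator a n) \<le> X ^ (2 + C * n)" by simp
    \<comment> \<open>Passing from \<open>X\<close> to \<open>exp X\<close> avoids logarithms: the
      exponent becomes \<open>X * (2 + C * n)\<close>, to which the choice of \<open>H0\<close>
      applies.\<close>
    also have "\<dots> \<le> exp X ^ (2 + C * n)"
    proof (rule power_mono)
      show "X \<le> exp X" using exp_ge_add_one_self[of X] by linarith
    qed (use X in simp)
    also have "\<dots> = exp (X * real (2 + C * n))" by (rule exp_of_nat2_mult[symmetric])
    also have "\<dots> \<le> exp (exp (exp (real H)))"
    proof -
      have "X * real (2 + C * n) = X * (2 + real C * real n)" by simp
      also have "\<dots> \<le> X * (2 + real C * X ^ D)"
        using X n_le by (intro mult_left_mono add_left_mono) auto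
      also have "\<dots> \<le> exp (exp (real H))" using H0[of "real H"] n by (simp only: H X_def of_int_of_nat_eq)
      finally show ?thesis by (simp only: exp_le_cancel_iff)
    qed
    finally show "denominator a n \<le> exp3 (alg_height (a n))" by (simp only: exp3_def H of_int_of_nat_eq)
  qed
qed

section \<open>Interpolating series\<close>

text \<open>The real parts of the complex Taylor coefficients at \<open>x\<close> give the real
  expansion: at a real argument the real part of the complex series is the series of real parts, so
  the radius of convergence does not shrink.\<close>

lemma real_analytic_if_entire_extension:
  fixes f :: "real \<Rightarrow> real"
  assumes F: "F holomorphic_on UNIV" and ext: "\<And>x. F (complex_of_real x) = of_real (f x)"
  shows "real_analytic f"
  unfolding real_analytic_def
proof
  fix x
  define P where "P = fps_expansion F (of_real x)"
  have "F analytic_on {of_real x}"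
    using F by (meson analytic_at holomorphic_on_subset open_UNIV UNIV_I)
  then have P: "(\<lambda>h. F (of_real x + h)) has_fps_expansion P"
    unfolding P_def by (rule analytic_at_imp_has_fps_expansion)
  define Q where "Q = Abs_fps (\<lambda>n. Re (fps_nth P n))"
  have sums: "(\<lambda>n. fps_nth Q n * h ^ n) sums Re (eval_fps P (of_real h))"
    if "ereal \<bar>h\<bar> < fps_conv_radius P" for h
  proof -
    have "(\<lambda>n. fps_nth P n * of_real h ^ n) sums eval_fps P (of_real h)"
      using that by (intro sums_eval_fps) simp
    then have "(\<lambda>n. Re (fps_nth P n * of_real h ^ n)) sums Re (eval_fps P (of_real h))"
      by (rule sums_Re)
    then show ?thesis by (simp add: Q_def flip: of_real_power)
  qed
  have "fps_conv_radius Q \<ge> fps_conv_radius P"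
    unfolding fps_conv_radius_def[of Q]
  proof (rule conv_radius_geI_ex')
    fix r assume "0 < r" "ereal r < fps_conv_radius P"
    then show "summable (\<lambda>n. fps_nth Q n * of_real r ^ n)"
      using sums[of r] by (simp add: sums_iff)
  qed
  moreover have "fps_conv_radius P > 0" using P by (simp add: has_fps_expansion_def)
  ultimately have rad: "fps_conv_radius Q > 0" by order
  obtain e where e: "0 < e" "ereal e < fps_conv_radius P"
    using \<open>fps_conv_radius P > 0\<close> ereal_dense2[of 0 "fps_conv_radius P"] by (auto simp: zero_ereal_def)
  from P have "eventually (\<lambda>z. eval_fps P z = F (of_real x + z)) (nhds 0)"
    by (simp add: has_fps_expansion_def)
  then obtain d where d: "d > 0" "\<And>z. norm z < d \<Longrightarrow> eval_fps P z = F (of_real x + z)"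
    by (auto simp: eventually_nhds_metric dist_norm)
  have "eventually (\<lambda>h :: real. \<bar>h\<bar> < min d e) (nhds 0)"
    using e d by (auto simp: eventually_nhds_metric dist_norm intro!: exI[of _ "min d e"])
  then have "eventually (\<lambda>h. eval_fps Q h = f (x + h)) (nhds 0)"
  proof eventually_elim
    case (elim h)
    then have "ereal \<bar>h\<bar> < fps_conv_radius P" using e by (auto intro: order_less_trans[of _ "ereal e"])
    then have "eval_fps Q h = Re (eval_fps P (of_real h))"
      using sums[of h] by (simp add: eval_fps_def sums_iff)
    also have "\<dots> = f (x + h)"
      using d(2)[of "of_real h"] elim ext[of "x + h"] by simp
    finally show ?case .
  qed
  with rad have "(\<lambda>h. f (x + h)) has_fps_expansion Q" by (simp add: has_fps_expansion_def)
  then show "\<exists>F. (\<lambda>h. f (x + h)) has_fps_expansion F" ..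
qed

section \<open>Growth at infinity and transcendence\<close>

lemma eventually_cmod_poly_ge:
  fixes p :: "complex poly"
  assumes "p \<noteq> 0"
  obtains \<delta> where "\<delta> > 0" "eventually (\<lambda>x :: real. \<delta> \<le> cmod (poly p (of_real x))) at_top"
proof (cases p)
  case (pCons a q)
  show thesis
  proof (cases "q = 0")
    case True
    then show thesis using assms pCons by (intro that[of "cmod a"]) auto
  next
    case False
    from poly_infinity[OF this, of 1 a] obtain r where r: "\<And>z. r \<le> cmod z \<Longrightarrow> 1 \<le> cmod (poly p z)"
      unfolding pCons by blast
    have "eventually (\<lambda>x :: real. 1 \<le> cmod (poly p (of_real x))) at_top"
      using eventually_ge_at_top[of "max r 0"] by eventually_elim (auto intro: r)
    then show thesis using that[of 1] by simp
  qed
qed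

lemma eventually_cmod_poly_le:
  fixes p :: "complex poly"
  assumes "degree p \<le> N"
  obtains K where "K \<ge> 0" "eventually (\<lambda>x :: real. cmod (poly p (of_real x)) \<le> K * x ^ N) at_top"
proof (rule that)
  show "0 \<le> (\<Sum>i\<le>degree p. cmod (coeff p i))" by (simp add: sum_nonneg)
  show "eventually (\<lambda>x :: real. cmod (poly p (of_real x)) \<le> (\<Sum>i\<le>degree p. cmod (coeff p i)) * x ^ N) at_top"
    using eventually_ge_at_top[of 1]
  proof eventually_elim
    case (elim x)
    have "cmod (poly p (of_real x)) \<le> (\<Sum>i\<le>degree p. cmod (coeff p i * of_real x ^ i))"
      unfolding poly_altdef by (rule norm_sum)
    also have "\<dots> \<le> (\<Sum>i\<le>degree p. cmod (coeff p i) * x ^ N)"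
      using elim assms by (intro sum_mono) (auto simp: norm_mult norm_power intro!: mult_left_mono power_increasing)
    finally show ?case by (simp add: sum_distrib_right)
  qed
qed

text \<open>In \<open>P(x, f x) = 0\<close> the term of highest degree in \<open>y\<close> dominates all the others.\<close>

lemma transcendental_fun_if_superpolynomial:
  assumes growth: "\<And>N. eventually (\<lambda>x. x ^ N \<le> f x) at_top"
  shows "transcendental_fun f"
  unfolding transcendental_fun_def
proof (intro allI impI, rule ccontr)
  fix P
  assume P0: "\<forall>x. eval_poly2 P (complex_of_real x) (complex_of_real (f x)) = 0" and "P \<noteq> 0"
  define d where "d = degree P"
  define p where "p j = coeff P j" for j
  define y where "y x = complex_of_real (f x)" for x
  have eq: "(\<Sum>j\<le>d. poly (p j) (of_real x) * y x ^ j) = 0" for x :: real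
  proof -
    have "eval_poly2 P (of_real x) (y x) = (\<Sum>j\<le>d. poly (p j) (of_real x) * y x ^ j)"
      by (simp add: eval_poly2_def d_def p_def poly_altdef[of P] poly_sum flip: poly_const_pow)
    then show ?thesis using P0 by (simp add: y_def)
  qed
  have "p d \<noteq> 0" using \<open>P \<noteq> 0\<close> by (simp add: p_def d_def)
  then obtain \<delta> where \<delta>: "\<delta> > 0" "eventually (\<lambda>x :: real. \<delta> \<le> cmod (poly (p d) (of_real x))) at_top"
    by (rule eventually_cmod_poly_ge)
  define N where "N = Max ((\<lambda>j. degree (p j)) ` {..d})"
  have "\<exists>K. K \<ge> 0 \<and> eventually (\<lambda>x :: real. cmod (poly (p j) (of_real x)) \<le> K * x ^ N) at_top"
    if "j \<le> d" for j
  proof -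
    have "degree (p j) \<le> N" using that unfolding N_def by (intro Max_ge) auto
    then show ?thesis by (rule eventually_cmod_poly_le) blast
  qed
  then obtain K where K: "\<And>j. j \<le> d \<Longrightarrow> K j \<ge> 0"
    "\<And>j. j \<le> d \<Longrightarrow> eventually (\<lambda>x :: real. cmod (poly (p j) (of_real x)) \<le> K j * x ^ N) at_top"
    by metis
  define M where "M = (\<Sum>j<d. K j)"
  have "eventually (\<lambda>x :: real. \<forall>j\<in>{..<d}. cmod (poly (p j) (of_real x)) \<le> K j * x ^ N) at_top"
    using K(2) by (intro eventually_ball_finite) auto
  \<comment> \<open>One power more than the common degree bound \<open>N\<close> makes
    \<open>f\<close> outgrow the coefficients of all lower terms.\<close>
  moreover note \<delta>(2) growth[of "Suc N"]
  moreover have "eventually (\<lambda>x. x \<ge> 1 \<and> x > M / \<delta>) at_top"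
    by (intro eventually_conj eventually_ge_at_top eventually_gt_at_top)
  ultimately have "eventually (\<lambda>x :: real. False) at_top"
  proof eventually_elim
    case (elim x)
    have x1: "1 \<le> x ^ n" for n using elim by simp
    have f1: "1 \<le> f x" using elim x1[of "Suc N"] by linarith
    have ny: "cmod (y x) = f x" using f1 by (simp add: y_def)
    have "poly (p d) (of_real x) * y x ^ d = - (\<Sum>j<d. poly (p j) (of_real x) * y x ^ j)"
      using eq[of x] by (simp add: lessThan_Suc_atMost[symmetric] add_eq_0_iff2 del: sum.lessThan_Suc)
        (simp add: add_eq_0_iff)
    then have "cmod (poly (p d) (of_real x)) * f x ^ d = cmod (\<Sum>j<d. poly (p j) (of_real x) * y x ^ j)"
      by (metis norm_minus_cancel norm_mult norm_power ny)
    also have "\<dots> \<le> (\<Sum>j<d. cmod (poly (p j) (of_real x)) * f x ^ j)"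
      by (rule order_trans[OF norm_sum]) (simp add: norm_mult norm_power ny)
    \<comment> \<open>Because \<open>f x\<close> is at least 1, every lower power is at most the one
      with exponent \<open>d - 1\<close>. For \<open>d = 0\<close> the sum is empty, so truncated
      subtraction does no harm.\<close>
    also have "\<dots> \<le> (\<Sum>j<d. K j * x ^ N * f x ^ (d - 1))"
      using elim f1 K(1) by (intro sum_mono mult_mono power_increasing) auto
    also have "\<dots> = M * x ^ N * f x ^ (d - 1)" by (simp add: M_def sum_distrib_right)
    finally have le: "cmod (poly (p d) (of_real x)) * f x ^ d \<le> M * x ^ N * f x ^ (d - 1)" .
    have "\<delta> * f x ^ d \<le> cmod (poly (p d) (of_real x)) * f x ^ d"
      using elim f1 by (intro mult_right_mono) auto
    with le have le: "\<delta> * f x ^ d \<le> M * x ^ N * f x ^ (d - 1)" by linarith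
    show False
    proof (cases "d = 0")
      case True
      then show False using le \<delta> by (simp add: M_def)
    next
      case False
      then have "f x ^ d = f x * f x ^ (d - 1)" by (simp add: power_eq_if)
      then have "\<delta> * f x \<le> M * x ^ N"
        using le f1 by (simp add: mult.assoc[symmetric])
      moreover have "M * x ^ N < \<delta> * x * x ^ N"
        using elim \<delta> x1[of N] by (intro mult_strict_right_mono) (auto simp: field_simps)
      moreover have "\<delta> * x * x ^ N \<le> \<delta> * f x"
        using elim \<delta> by (simp add: mult.assoc)
      ultimately show False by linarith
    qed
  qed
  then show False by simp
qed

text \<open>
  Newton interpolation with double nodes: the later terms vanish at \<open>a n\<close>, so \<open>newton_coeff\<close> can be
  chosen to make the value at \<open>a n\<close> a fraction with the given denominator. The choice between two
  admissible numerators is encoded by \<open>b\<close>.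
\<close>

fun newton_coeff :: "(nat \<Rightarrow> real) \<Rightarrow> nat set \<Rightarrow> nat \<Rightarrow> real" where
  "newton_coeff a b n =
     (let t = (\<Sum>k<n. newton_coeff a b k * node_poly a k (a n))
      in ((of_int \<lfloor>t * of_int (denominator a n)\<rfloor> + 1 + of_bool (n \<in> b)) / of_int (denominator a n) - t)
           / node_poly a n (a n))"

declare newton_coeff.simps [simp del]

definition newton_fun :: "(nat \<Rightarrow> real) \<Rightarrow> nat set \<Rightarrow> real \<Rightarrow> real" where
  "newton_fun a b x = (\<Sum>n. newton_coeff a b n * node_poly a n x)"

text \<open>The complex extension supplies the Taylor expansions, the isolation of zeros and the
  derivative for \<open>newton_fun\<close>.\<close>

definition newton_cfun :: "(nat \<Rightarrow> real) \<Rightarrow> nat set \<Rightarrow> complex \<Rightarrow> complex" where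
  "newton_cfun a b z = (\<Sum>n. of_real (newton_coeff a b n) * node_poly (\<lambda>k. of_real (a k)) n z)"

section \<open>Bounds for nodes, denominators and coefficients\<close>

lemma node_poly_of_real: "node_poly (\<lambda>k. complex_of_real (a k)) n (of_real x) = of_real (node_poly a n x)"
  by (simp add: node_poly_def)

lemma node_poly_nonneg: "0 \<le> node_poly a n (x :: real)"
  by (simp add: node_poly_def prod_nonneg)

lemma node_poly_eq_0: "n < k \<Longrightarrow> node_poly a k (a n) = (0 :: real)"
  by (force simp: node_poly_def)

lemma coeff_bound_pos: "0 < coeff_bound a n"
proof -
  have "0 < (real n + \<bar>a k\<bar>)\<^sup>2" if "k < n" for k using that by (simp add: add_pos_nonneg)
  then show ?thesis unfolding coeff_bound_def by (auto intro!: mult_pos_pos prod_pos)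
qed

lemma node_poly_pos: "inj a \<Longrightarrow> 0 < node_poly a n (a n :: real)"
  unfolding node_poly_def by (intro prod_pos) (auto dest: injD)

lemma denominator_ge_2:
  assumes "inj a" shows "denominator a n \<ge> 2"
proof -
  have "0 < 2 / (coeff_bound a n * node_poly a n (a n))"
    using coeff_bound_pos[of a n] node_poly_pos[OF assms, of n] by simp
  then have "0 < \<lceil>2 / (coeff_bound a n * node_poly a n (a n))\<rceil>" by linarith
  then show ?thesis unfolding denominator_def by linarith
qed

text \<open>The chosen numerator is the first or second integer strictly above \<open>t * D\<close>,
  so its distance \<open>w\<close> to \<open>t * D\<close> is positive and at most 2. The
  denominator is large enough to bring \<open>2 / D / g\<close> under the bound.\<close>

lemma newton_coeff_bounds:
  assumes "inj a"
  shows "0 < newton_coeff a b n" "newton_coeff a b n \<le> coeff_bound a n"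
proof -
  define D where "D = real_of_int (denominator a n)"
  define g where "g = node_poly a n (a n)"
  define t where "t = (\<Sum>k<n. newton_coeff a b k * node_poly a k (a n))"
  define w where "w = real_of_int \<lfloor>t * D\<rfloor> + 1 + of_bool (n \<in> b) - t * D"
  have D: "D > 0" using denominator_ge_2[OF assms, of n] unfolding D_def by linarith
  have g: "g > 0" unfolding g_def by (rule node_poly_pos[OF assms])
  have c: "newton_coeff a b n = w / D / g"
    using D by (subst newton_coeff.simps) (simp add: Let_def w_def t_def D_def g_def field_simps)
  have w: "0 < w" "w \<le> 2" unfolding w_def by (cases "n \<in> b"; simp; linarith)+
  show "0 < newton_coeff a b n" unfolding c using w D g by simp
  have "2 / (coeff_bound a n * g) \<le> D" unfolding D_def denominator_def g_def by linarith
  then have "2 / D / g \<le> coeff_bound a n"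
    using D g coeff_bound_pos[of a n] by (simp add: field_simps)
  moreover have "w / D / g \<le> 2 / D / g" using w D g by (intro divide_right_mono) auto
  ultimately show "newton_coeff a b n \<le> coeff_bound a n" unfolding c by linarith
qed

lemma norm_newton_term_le:
  assumes "inj a" "norm z \<le> real n"
  shows "norm (of_real (newton_coeff a b n) * node_poly (\<lambda>k. complex_of_real (a k)) n z) \<le> (1 / 2) ^ n"
proof -
  define Q where "Q = (\<Prod>k<n. (real n + \<bar>a k\<bar>)\<^sup>2)"
  have "norm (z - of_real (a k)) \<le> real n + \<bar>a k\<bar>" for k
    using norm_triangle_ineq4[of z "of_real (a k)"] assms by simp
  then have "norm (node_poly (\<lambda>k. complex_of_real (a k)) n z) \<le> Q"
    unfolding node_poly_def Q_def prod_norm[symmetric] norm_power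
    by (intro prod_mono conjI power_mono) auto
  moreover have "\<bar>newton_coeff a b n\<bar> \<le> coeff_bound a n"
    using newton_coeff_bounds[OF assms(1), of b n] by linarith
  ultimately have "norm (of_real (newton_coeff a b n) * node_poly (\<lambda>k. complex_of_real (a k)) n z) \<le> coeff_bound a n * Q"
    unfolding norm_mult norm_of_real using coeff_bound_pos[of a n] by (intro mult_mono) auto
  also have "\<dots> = (1 / 2) ^ n"
    using coeff_bound_pos[of a n] unfolding coeff_bound_def Q_def by (auto simp: power_divide)
  finally show ?thesis .
qed

section \<open>Convergence and holomorphy\<close>

lemma newton_uniform_limit:
  assumes "inj a"
  shows "uniform_limit (cball 0 R) (\<lambda>N z. \<Sum>n<N. of_real (newton_coeff a b n) * node_poly (\<lambda>k. of_real (a k)) n z)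
           (newton_cfun a b) sequentially"
  unfolding newton_cfun_def
proof (rule Weierstrass_m_test_ev)
  show "summable (\<lambda>n. (1 / 2 :: real) ^ n)" by (intro summable_geometric) auto
  \<comment> \<open>The \<open>n\<close>-th term is controlled on the disc of radius
    \<open>n\<close>, so for fixed \<open>R\<close> the estimate is available from index
    \<open>R\<close> on.\<close>
  have "eventually (\<lambda>n. R \<le> real n) sequentially" by real_asymp
  then show "\<forall>\<^sub>F n in sequentially. \<forall>z\<in>cball 0 R.
      norm (of_real (newton_coeff a b n) * node_poly (\<lambda>k. complex_of_real (a k)) n z) \<le> (1 / 2) ^ n"
    by eventually_elim (use assms in \<open>auto intro!: norm_newton_term_le\<close>)
qed

lemma newton_cfun_holomorphic:
  assumes "inj a" shows "newton_cfun a b holomorphic_on UNIV"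
proof (rule holomorphic_uniform_sequence)
  show "(\<lambda>z. \<Sum>n<N. of_real (newton_coeff a b n) * node_poly (\<lambda>k. complex_of_real (a k)) n z) holomorphic_on UNIV" for N
    unfolding node_poly_def by (intro holomorphic_intros)
  fix x :: complex
  have "cball x 1 \<subseteq> cball 0 (norm x + 1)"
    by (simp add: cball_subset_cball_iff dist_norm)
  then show "\<exists>d>0. cball x d \<subseteq> UNIV \<and> uniform_limit (cball x d)
      (\<lambda>N z. \<Sum>n<N. of_real (newton_coeff a b n) * node_poly (\<lambda>k. complex_of_real (a k)) n z) (newton_cfun a b) sequentially"
    by (intro exI[of _ 1] conjI uniform_limit_on_subset[OF newton_uniform_limit[OF assms]]) auto
qed simp

lemma newton_sums:
  assumes "inj a"
  shows "(\<lambda>n. newton_coeff a b n * node_poly a n x) sums newton_fun a b x"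
    and newton_cfun_of_real: "newton_cfun a b (of_real x) = of_real (newton_fun a b x)"
proof -
  let ?t = "\<lambda>n. of_real (newton_coeff a b n) * node_poly (\<lambda>k. complex_of_real (a k)) n (of_real x)"
  have "(\<lambda>N. \<Sum>n<N. ?t n) \<longlonglongrightarrow> newton_cfun a b (of_real x)"
    by (rule tendsto_uniform_limitI[OF newton_uniform_limit[OF assms, where R = "\<bar>x\<bar>"]]) simp
  then have "?t sums newton_cfun a b (of_real x)" by (simp add: sums_def)
  then have *: "(\<lambda>n. complex_of_real (newton_coeff a b n * node_poly a n x)) sums newton_cfun a b (of_real x)"
    by (simp add: node_poly_of_real)
  from sums_Re[OF *] have "summable (\<lambda>n. newton_coeff a b n * node_poly a n x)"
    by (simp add: sums_iff)
  then show s: "(\<lambda>n. newton_coeff a b n * node_poly a n x) sums newton_fun a b x"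
    unfolding newton_fun_def by (rule summable_sums)
  show "newton_cfun a b (of_real x) = of_real (newton_fun a b x)"
    using sums_unique2[OF * sums_of_real[OF s]] .
qed

section \<open>Growth on the real line, values at the nodes and injectivity\<close>

lemma newton_fun_ge:
  assumes "inj a" shows "newton_coeff a b N * node_poly a N x \<le> newton_fun a b x"
proof -
  \<comment> \<open>The squares in \<open>node_poly\<close> make every term nonnegative at real
    points.\<close>
  have "0 \<le> newton_coeff a b n * node_poly a n x" for n
    using newton_coeff_bounds(1)[OF assms, of b n] node_poly_nonneg[of a n x] by simp
  then have "(\<Sum>n\<in>{N}. newton_coeff a b n * node_poly a n x) \<le> newton_fun a b x"
    unfolding newton_fun_def
    using newton_sums(1)[OF assms, of b x] by (intro sum_le_suminf) (auto simp: sums_iff)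
  then show ?thesis by simp
qed

lemma newton_fun_growth:
  assumes "inj a" shows "eventually (\<lambda>x. x ^ N \<le> newton_fun a b x) at_top"
proof -
  define M where "M = Max (insert 0 ((\<lambda>k. \<bar>a k\<bar>) ` {..<Suc N}))"
  have M: "\<bar>a k\<bar> \<le> M" if "k < Suc N" for k
    unfolding M_def using that by (intro Max_ge) auto
  have M0: "0 \<le> M" unfolding M_def by (intro Max_ge) auto
  define c where "c = newton_coeff a b (Suc N)"
  have c: "c > 0" unfolding c_def by (rule newton_coeff_bounds[OF assms])
  show ?thesis
    \<comment> \<open>The single term of index \<open>Suc N\<close>, of degree
      \<open>2 * Suc N\<close>, suffices. Past the first threshold each \<open>x - a k\<close> is at
      least \<open>x / 2\<close>; the second absorbs the constant \<open>4 ^ Suc N\<close> from the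
      squared halves.\<close>
    using eventually_ge_at_top[of "2 * M + 1"] eventually_ge_at_top[of "4 ^ Suc N / c"]
  proof eventually_elim
    case (elim x)
    then have x: "x \<ge> 2 * M + 1" "4 ^ Suc N \<le> c * x" using c by (auto simp: field_simps)
    have x1: "1 \<le> x" using x M0 by linarith
    have "((x / 2)\<^sup>2) ^ Suc N = (\<Prod>k<Suc N. (x / 2)\<^sup>2)" by simp
    also have "\<dots> \<le> node_poly a (Suc N) x"
      unfolding node_poly_def
    proof (intro prod_mono conjI power_mono)
      fix k assume "k \<in> {..<Suc N}"
      then show "x / 2 \<le> x - a k" using M[of k] x by auto
    qed (use x1 in auto)
    finally have "c * ((x / 2)\<^sup>2) ^ Suc N \<le> newton_fun a b x"
      using newton_fun_ge[OF assms, of b "Suc N" x] c unfolding c_def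
      by (meson mult_left_mono order_trans less_imp_le)
    moreover have "4 ^ Suc N * x ^ N \<le> 4 ^ Suc N * (c * ((x / 2)\<^sup>2) ^ Suc N)"
    proof -
      have "4 ^ Suc N * x ^ N \<le> c * x * x ^ N" using x x1 by (intro mult_right_mono) auto
      also have "\<dots> \<le> c * x ^ Suc N * x ^ Suc N" using c x1 one_le_power[OF x1, of "Suc N"] 
        by (simp add: mult.assoc)
      also have "\<dots> = 4 ^ Suc N * (c * ((x / 2)\<^sup>2) ^ Suc N)"
        by (simp add: power_divide power2_eq_square power_mult_distrib del: power_Suc)
      finally show ?thesis .
    qed
    ultimately show ?case by (simp del: power_Suc)
  qed
qed

lemma newton_fun_node:
  assumes "inj a"
  shows "newton_fun a b (a n) =
    (of_int \<lfloor>(\<Sum>k<n. newton_coeff a b k * node_poly a k (a n)) * of_int (denominator a n)\<rfloor> + 1 + of_bool (n \<in> b))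
       / of_int (denominator a n)"
proof -
  have "(\<lambda>k. newton_coeff a b k * node_poly a k (a n)) sums
        (\<Sum>k<Suc n. newton_coeff a b k * node_poly a k (a n))"
    by (rule sums_finite) (auto simp: node_poly_eq_0)
  then have "newton_fun a b (a n) = (\<Sum>k<Suc n. newton_coeff a b k * node_poly a k (a n))"
    by (rule sums_unique2[OF newton_sums(1)[OF assms]])
  also have "\<dots> = (\<Sum>k<n. newton_coeff a b k * node_poly a k (a n)) + newton_coeff a b n * node_poly a n (a n)"
    by simp
  also have "newton_coeff a b n * node_poly a n (a n) =
      (of_int \<lfloor>(\<Sum>k<n. newton_coeff a b k * node_poly a k (a n)) * of_int (denominator a n)\<rfloor> + 1 + of_bool (n \<in> b))
       / of_int (denominator a n) - (\<Sum>k<n. newton_coeff a b k * node_poly a k (a n))"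
    using node_poly_pos[OF assms, of n] by (subst newton_coeff.simps) (simp add: Let_def)
  finally show ?thesis by (simp only: add_diff_cancel_left' diff_add_cancel add.commute)
qed

text \<open>At the least index \<open>n\<close> where \<open>b\<close> and \<open>b'\<close> differ,
  all earlier coefficients agree, so the partial sums at \<open>a n\<close> are equal and the two
  values there differ by \<open>1 / denominator a n\<close>.\<close>

lemma inj_newton_fun:
  assumes "inj a" shows "inj (newton_fun a)"
proof (rule injI, rule ccontr)
  fix b b' assume eq: "newton_fun a b = newton_fun a b'" and ne: "b \<noteq> b'"
  define n where "n = (LEAST n. (n \<in> b) \<noteq> (n \<in> b'))"
  from ne have ex: "\<exists>n. (n \<in> b) \<noteq> (n \<in> b')" by (simp add: set_eq_iff)
  have n: "(n \<in> b) \<noteq> (n \<in> b')" unfolding n_def by (rule LeastI_ex[OF ex])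
  have agree: "(k \<in> b) = (k \<in> b')" if "k < n" for k
    using not_less_Least[OF that[unfolded n_def]] by simp
  have "k < n \<Longrightarrow> newton_coeff a b k = newton_coeff a b' k" for k
  proof (induction k rule: less_induct)
    case (less k)
    then have "(\<Sum>j<k. newton_coeff a b j * node_poly a j (a k)) = (\<Sum>j<k. newton_coeff a b' j * node_poly a j (a k))"
      by (intro sum.cong) auto
    then show ?case
      by (simp only: newton_coeff.simps[of a b k] newton_coeff.simps[of a b' k] agree[OF less.prems])
  qed
  then have "(\<Sum>k<n. newton_coeff a b k * node_poly a k (a n)) = (\<Sum>k<n. newton_coeff a b' k * node_poly a k (a n))"
    by (intro sum.cong) auto
  with fun_cong[OF eq, of "a n"]
  have "of_bool (n \<in> b) / real_of_int (denominator a n) = of_bool (n \<in> b') / of_int (denominator a n)"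
    by (simp only: newton_fun_node[OF assms] add_divide_distrib add_left_cancel)
  moreover have "real_of_int (denominator a n) \<noteq> 0" using denominator_ge_2[OF assms, of n] by simp
  ultimately have "of_bool (n \<in> b) = (of_bool (n \<in> b') :: real)" by simp
  then show False using n by (cases "n \<in> b'") simp_all
qed

lemma real_analytic_newton_fun: "inj a \<Longrightarrow> real_analytic (newton_fun a b)"
  by (rule real_analytic_if_entire_extension[OF newton_cfun_holomorphic newton_cfun_of_real])

lemma transcendental_newton_fun: "inj a \<Longrightarrow> transcendental_fun (newton_fun a b)"
  by (rule transcendental_fun_if_superpolynomial[OF newton_fun_growth])

section \<open>Local behaviour: isolated values and a Lipschitz bound\<close>

lemma eventually_at_of_real:
  assumes "eventually P (at (complex_of_real x))"
  shows "eventually (\<lambda>y. P (of_real y)) (at x)"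
proof -
  from assms obtain d where "d > 0" "\<And>z. z \<noteq> of_real x \<Longrightarrow> dist z (of_real x) < d \<Longrightarrow> P z"
    by (auto simp: eventually_at)
  then show ?thesis
    by (auto simp: eventually_at dist_norm norm_of_real simp flip: of_real_diff intro!: exI[of _ d])
qed

text \<open>By its growth the function is not constant, so zeros of the entire function
  \<open>newton_cfun a b z - newton_cfun a b x\<close> are isolated.\<close>

lemma newton_fun_eventually_neq:
  assumes "inj a" shows "eventually (\<lambda>y. newton_fun a b y \<noteq> newton_fun a b x) (at x)"
proof -
  have "eventually (\<lambda>y. y ^ 1 \<le> newton_fun a b y \<and> y > newton_fun a b x) at_top"
    by (intro eventually_conj newton_fun_growth[OF assms] eventually_gt_at_top)
  then obtain y where "y ^ 1 \<le> newton_fun a b y \<and> y > newton_fun a b x"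
    using eventually_happens'[OF trivial_limit_at_top_linorder] by blast
  then have y: "newton_fun a b y \<noteq> newton_fun a b x" by auto
  define f where "f z = newton_cfun a b z - newton_cfun a b (of_real x)" for z
  have fr: "f (of_real t) = of_real (newton_fun a b t - newton_fun a b x)" for t
    by (simp add: f_def newton_cfun_of_real[OF assms])
  have "f holomorphic_on UNIV"
    unfolding f_def by (intro holomorphic_intros newton_cfun_holomorphic[OF assms])
  moreover have "f (of_real x) = 0" "f (of_real y) \<noteq> 0" using y unfolding fr by auto
  ultimately obtain r where r: "0 < r" "\<And>z. z \<in> ball (of_real x) r - {of_real x} \<Longrightarrow> f z \<noteq> 0"
    by (rule isolated_zeros[OF _ open_UNIV connected_UNIV UNIV_I _ UNIV_I]) blast
  then have "eventually (\<lambda>z. f z \<noteq> 0) (at (complex_of_real x))"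
    unfolding eventually_at by (intro exI[of _ r]) (simp add: dist_commute)
  from eventually_at_of_real[OF this] show ?thesis
    by eventually_elim (simp add: fr del: of_real_diff)
qed

text \<open>Near \<open>x\<close> the complex difference quotient has norm below that of the
  derivative plus 1.\<close>

lemma newton_fun_eventually_lipschitz:
  assumes "inj a"
  obtains K where "eventually (\<lambda>y. \<bar>newton_fun a b y - newton_fun a b x\<bar> \<le> K * \<bar>y - x\<bar>) (at x)"
proof -
  let ?F = "newton_cfun a b"
  obtain D where "(?F has_field_derivative D) (at (of_real x))"
    using newton_cfun_holomorphic[OF assms] by (auto simp: holomorphic_on_def field_differentiable_def)
  then have "((\<lambda>z. (?F z - ?F (of_real x)) / (z - of_real x)) \<longlongrightarrow> D) (at (of_real x))"
    by (simp add: has_field_derivative_iff)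
  then have "((\<lambda>z. norm ((?F z - ?F (of_real x)) / (z - of_real x))) \<longlongrightarrow> norm D) (at (of_real x))"
    by (rule tendsto_norm)
  then have "eventually (\<lambda>z. norm ((?F z - ?F (of_real x)) / (z - of_real x)) < norm D + 1) (at (complex_of_real x))"
    by (rule order_tendstoD) simp
  then have "eventually (\<lambda>y. norm ((?F (of_real y) - ?F (of_real x)) / (of_real y - of_real x)) < norm D + 1) (at x)"
    by (rule eventually_at_of_real)
  moreover have "eventually (\<lambda>y. y \<noteq> x) (at x)" by (auto simp: eventually_at_filter)
  ultimately have "eventually (\<lambda>y. \<bar>newton_fun a b y - newton_fun a b x\<bar> \<le> (norm D + 1) * \<bar>y - x\<bar>) (at x)"
  proof eventually_elim
    case (elim y)
    then have "\<bar>newton_fun a b y - newton_fun a b x\<bar> / \<bar>y - x\<bar> < norm D + 1"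
      by (simp add: newton_cfun_of_real[OF assms] norm_divide flip: of_real_diff)
    then show ?case using elim by (simp add: divide_simps split: if_splits)
  qed
  then show thesis by (rule that)
qed

section \<open>Ultra numbers and Liouville numbers\<close>

lemma newton_fun_node_rational:
  assumes "inj a"
  obtains p :: int where "newton_fun a b (a n) = of_int p / of_int (denominator a n)"
proof (rule that)
  show "newton_fun a b (a n) =
    of_int (\<lfloor>(\<Sum>k<n. newton_coeff a b k * node_poly a k (a n)) * of_int (denominator a n)\<rfloor> + 1 + of_bool (n \<in> b))
      / of_int (denominator a n)"
    unfolding newton_fun_node[OF assms] by simp
qed

lemma exp3_ge_2: "0 \<le> x \<Longrightarrow> 2 \<le> exp3 x"
  unfolding exp3_def using exp_ge_add_one_self[of "exp (exp x)"] one_le_exp_iff[of x] one_le_exp_iff[of "exp x"]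
  by linarith

text \<open>As \<open>exp3\<close> is at least 2 here, the error is at most
  \<open>(1 / 2) ^ n\<close>. Convergence in the punctured sense lets every property valid near
  \<xi> pass to \<open>\<alpha> n\<close> for large \<open>n\<close>.\<close>

lemma filterlim_ultra_approximation:
  fixes \<alpha> :: "nat \<Rightarrow> real"
  assumes "\<And>n. n \<ge> 1 \<Longrightarrow> 0 < \<bar>\<xi> - \<alpha> n\<bar> \<and> \<bar>\<xi> - \<alpha> n\<bar> < 1 / exp3 (of_int (alg_height (\<alpha> n))) ^ n"
  shows "filterlim \<alpha> (at \<xi>) sequentially"
proof (rule filterlim_atI)
  show "eventually (\<lambda>n. \<alpha> n \<noteq> \<xi>) sequentially"
    using eventually_ge_at_top[of 1] by eventually_elim (use assms in force)
  have "eventually (\<lambda>n. norm (\<alpha> n - \<xi>) \<le> (1 / 2) ^ n) sequentially"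
    using eventually_ge_at_top[of 1]
  proof eventually_elim
    case (elim n)
    have "(2 :: real) ^ n \<le> exp3 (of_int (alg_height (\<alpha> n))) ^ n"
      by (intro power_mono exp3_ge_2) (simp_all add: alg_height_nonneg)
    then have "1 / exp3 (of_int (alg_height (\<alpha> n))) ^ n \<le> 1 / 2 ^ n"
      by (intro frac_le) auto
    then have "\<bar>\<xi> - \<alpha> n\<bar> \<le> 1 / 2 ^ n" using assms[OF elim] by linarith
    then show ?case by (simp add: power_one_over abs_minus_commute)
  qed
  moreover have "(\<lambda>n. (1 / 2 :: real) ^ n) \<longlonglongrightarrow> 0" by (rule LIMSEQ_realpow_zero) auto
  ultimately have "(\<lambda>n. \<alpha> n - \<xi>) \<longlonglongrightarrow> 0" by (rule Lim_null_comparison)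
  then show "\<alpha> \<longlonglongrightarrow> \<xi>" by (simp add: LIM_zero_iff)
qed

lemma newton_fun_ultra_liouville:
  assumes m: "m \<ge> 1" and inj: "inj a" and ran: "range a = real_algebraic_le m"
    and mono: "\<And>k n. k \<le> n \<Longrightarrow> alg_height (a k) \<le> alg_height (a n)"
    and \<xi>: "\<xi> \<in> ultra_numbers m"
  shows "newton_fun a b \<xi> \<in> liouville_numbers"
proof -
  define \<phi> where "\<phi> = newton_fun a b"
  define E where "E x = exp3 (of_int (alg_height x))" for x :: real
  have E2: "2 \<le> E x" for x unfolding E_def by (rule exp3_ge_2) (simp add: alg_height_nonneg)
  from \<xi> obtain \<alpha> :: "nat \<Rightarrow> real" where \<alpha>: "\<And>n. n \<ge> 1 \<Longrightarrow> algebraic (\<alpha> n)" "\<And>n. n \<ge> 1 \<Longrightarrow> alg_degree (\<alpha> n) = m"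
    "\<And>n. n \<ge> 1 \<Longrightarrow> 0 < \<bar>\<xi> - \<alpha> n\<bar> \<and> \<bar>\<xi> - \<alpha> n\<bar> < 1 / E (\<alpha> n) ^ n"
    unfolding ultra_numbers_def E_def by blast
  have lim: "filterlim \<alpha> (at \<xi>) sequentially"
    using \<alpha>(3) unfolding E_def by (rule filterlim_ultra_approximation)
  obtain H0 :: real where H0: "\<And>n. H0 \<le> alg_height (a n) \<Longrightarrow> denominator a n \<le> exp3 (alg_height (a n))"
    by (rule denominator_le_exp3[OF m inj equalityD1[OF ran] mono]) (assumption, rule that)
  obtain K where K: "eventually (\<lambda>y. \<bar>\<phi> y - \<phi> \<xi>\<bar> \<le> K * \<bar>y - \<xi>\<bar>) (at \<xi>)"
    unfolding \<phi>_def by (rule newton_fun_eventually_lipschitz[OF inj])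
  \<comment> \<open>The maximum makes the constant positive, which keeps a later inequality
    strict.\<close>
  define K' where "K' = max K 1"
  \<comment> \<open>The numbers too low for the denominator bound form a finite set, which
    \<open>\<alpha> n\<close> eventually avoids even if \<xi> belongs to it.\<close>
  define T where "T = {x \<in> real_algebraic_le m. alg_height x \<le> int (nat \<lceil>H0\<rceil>)}"
  have "finite T" unfolding T_def by (rule finite_card_bounded_height)
  then have "eventually (\<lambda>y. \<forall>t\<in>T. y \<noteq> t) (at \<xi>)"
    by (intro eventually_ball_finite ballI eventually_neq_at_within)
  moreover have "eventually (\<lambda>y. \<phi> y \<noteq> \<phi> \<xi>) (at \<xi>)"
    unfolding \<phi>_def by (rule newton_fun_eventually_neq[OF inj])
  ultimately have "eventually (\<lambda>y. (\<forall>t\<in>T. y \<noteq> t) \<and> \<phi> y \<noteq> \<phi> \<xi> \<and> \<bar>\<phi> y - \<phi> \<xi>\<bar> \<le> K * \<bar>y - \<xi>\<bar>) (at \<xi>)"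
    using K by (intro eventually_conj)
  then have ev: "eventually (\<lambda>n. (\<forall>t\<in>T. \<alpha> n \<noteq> t) \<and> \<phi> (\<alpha> n) \<noteq> \<phi> \<xi> \<and> \<bar>\<phi> (\<alpha> n) - \<phi> \<xi>\<bar> \<le> K * \<bar>\<alpha> n - \<xi>\<bar>) sequentially"
    by (rule eventually_compose_filterlim[OF _ lim])
  have "\<exists>p q :: int. q > 1 \<and> 0 < \<bar>\<phi> \<xi> - of_int p / of_int q\<bar> \<and> \<bar>\<phi> \<xi> - of_int p / of_int q\<bar> < 1 / of_int q ^ k" for k
  proof -
    \<comment> \<open>Since \<open>E\<close> is at least 2, \<open>N\<close> of its factors absorb
      the Lipschitz constant, and \<open>k\<close> further ones absorb \<open>q ^ k\<close>; thus
      \<open>n \<ge> k + N\<close> is enough.\<close>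
    obtain N where N: "K' < 2 ^ N" using real_arch_pow[of 2 K'] by auto
    have "eventually (\<lambda>n. n \<ge> 1 \<and> n \<ge> k + N) sequentially"
      by (intro eventually_conj eventually_ge_at_top)
    with ev have "eventually (\<lambda>n. ((\<forall>t\<in>T. \<alpha> n \<noteq> t) \<and> \<phi> (\<alpha> n) \<noteq> \<phi> \<xi> \<and> \<bar>\<phi> (\<alpha> n) - \<phi> \<xi>\<bar> \<le> K * \<bar>\<alpha> n - \<xi>\<bar>) \<and>
        n \<ge> 1 \<and> n \<ge> k + N) sequentially"
      by (rule eventually_conj)
    then obtain n where n: "\<alpha> n \<notin> T" "\<phi> (\<alpha> n) \<noteq> \<phi> \<xi>" "\<bar>\<phi> (\<alpha> n) - \<phi> \<xi>\<bar> \<le> K * \<bar>\<alpha> n - \<xi>\<bar>" "n \<ge> 1" "n \<ge> k + N"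
      using eventually_happens'[OF sequentially_bot] by blast
    have "\<alpha> n \<in> real_algebraic_le m" using \<alpha>(1,2)[OF n(4)] by (simp add: real_algebraic_le_def)
    with ran obtain j where j: "\<alpha> n = a j" by blast
    define q where "q = denominator a j"
    have "H0 \<le> alg_height (a j)"
    proof -
      have "int (nat \<lceil>H0\<rceil>) < alg_height (a j)"
        using n(1) \<open>\<alpha> n \<in> real_algebraic_le m\<close> unfolding T_def j by (simp add: not_le)
      then show ?thesis by linarith
    qed
    then have qE: "of_int q \<le> E (\<alpha> n)" unfolding q_def j E_def by (rule H0)
    have q2: "q \<ge> 2" unfolding q_def by (rule denominator_ge_2[OF inj])
    obtain p where p: "\<phi> (\<alpha> n) = of_int p / of_int q"
      unfolding \<phi>_def j q_def by (rule newton_fun_node_rational[OF inj])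
    have "K' * of_int q ^ k \<le> E (\<alpha> n) ^ N * E (\<alpha> n) ^ k"
    proof (rule mult_mono)
      have "(2 :: real) ^ N \<le> E (\<alpha> n) ^ N" by (intro power_mono E2) simp
      with N show "K' \<le> E (\<alpha> n) ^ N" by linarith
      show "of_int q ^ k \<le> E (\<alpha> n) ^ k" using qE q2 by (intro power_mono) auto
      show "0 \<le> E (\<alpha> n) ^ N" using E2[of "\<alpha> n"] by (intro zero_le_power) linarith
      show "0 \<le> (of_int q :: real) ^ k" using q2 by simp
    qed
    also have "\<dots> = E (\<alpha> n) ^ (k + N)" by (simp add: power_add)
    also have "\<dots> \<le> E (\<alpha> n) ^ n" using n(5) E2[of "\<alpha> n"] by (intro power_increasing) auto
    finally have KE: "K' * of_int q ^ k \<le> E (\<alpha> n) ^ n" .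
    have Epos: "0 < E (\<alpha> n) ^ n" using E2[of "\<alpha> n"] by (intro zero_less_power) linarith
    have "\<bar>\<phi> \<xi> - of_int p / of_int q\<bar> \<le> K * \<bar>\<xi> - \<alpha> n\<bar>"
      using n(3) unfolding p by (simp only: abs_minus_commute)
    also have "\<dots> \<le> K' * \<bar>\<xi> - \<alpha> n\<bar>" unfolding K'_def by (intro mult_right_mono) auto
    also have "\<dots> < K' * (1 / E (\<alpha> n) ^ n)"
      using \<alpha>(3)[OF n(4)] by (intro mult_strict_left_mono) (auto simp: K'_def)
    also have "\<dots> \<le> 1 / of_int q ^ k"
      using KE Epos q2 by (simp add: field_simps)
    finally have "\<bar>\<phi> \<xi> - of_int p / of_int q\<bar> < 1 / of_int q ^ k" .
    moreover have "0 < \<bar>\<phi> \<xi> - of_int p / of_int q\<bar>" using n(2) unfolding p by auto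
    ultimately show ?thesis using q2 by (intro exI[of _ p] exI[of _ q]) auto
  qed
  then obtain p q :: "nat \<Rightarrow> int" where "\<And>k. q k > 1 \<and> 0 < \<bar>\<phi> \<xi> - of_int (p k) / of_int (q k)\<bar> \<and>
      \<bar>\<phi> \<xi> - of_int (p k) / of_int (q k)\<bar> < 1 / of_int (q k) ^ k"
    by metis
  then show ?thesis unfolding liouville_numbers_def \<phi>_def by blast
qed

section \<open>Uncountably many functions from the sets of naturals\<close>

lemma uncountable_UNIV_nat_set: "uncountable (UNIV :: nat set set)"
  using Cantors_theorem[of "UNIV :: nat set"] by (simp add: uncountable_def)

theorem theorem1:
  fixes m :: nat
  assumes "m \<ge> 1"
  shows "uncountable {\<phi> :: real \<Rightarrow> real.
           real_analytic \<phi> \<and> transcendental_fun \<phi> \<and> \<phi> ` ultra_numbers m \<subseteq> liouville_numbers}"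
proof -
  \<comment> \<open>For negative \<open>h\<close> the value \<open>nat h\<close> is 0, and the
    inclusion in a finite set persists.\<close>
  have fin: "finite {x \<in> real_algebraic_le m. alg_height x \<le> h}" for h
    by (rule finite_subset[OF _ finite_card_bounded_height(1)[of m "nat h"]]) auto
  obtain a :: "nat \<Rightarrow> real" where a: "inj a" "range a = real_algebraic_le m" "\<And>k n. k \<le> n \<Longrightarrow> alg_height (a k) \<le> alg_height (a n)"
    by (rule enumerate_by_rank[OF infinite_real_algebraic_le[OF assms] fin]) blast
  have "range (newton_fun a) \<subseteq>
      {\<phi>. real_analytic \<phi> \<and> transcendental_fun \<phi> \<and> \<phi> ` ultra_numbers m \<subseteq> liouville_numbers}"
    by (intro image_subsetI CollectI conjI real_analytic_newton_fun transcendental_newton_fun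
        newton_fun_ultra_liouville[OF assms] a)
  moreover have "uncountable (range (newton_fun a))"
    using countable_image_inj_on[OF _ inj_newton_fun[OF a(1)]] uncountable_UNIV_nat_set by blast
  ultimately show ?thesis using countable_subset by metis
qed

end
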